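(* Let $X(x):\mathbb{R}^m\to T_xM$, $x\in M$, be linear, surjective and $C^\infty$ in $x$, let $e_1,\dots,e_m$ be an orthonormal basis of $\mathbb{R}^m$ and $X^i=X(\cdot)e_i$. For a smooth differential $q$-form $\phi$ on $M$ set $$\bar\delta\phi=-\sum_{i=1}^m i_{X^i}\big(\hat\nabla\phi(X^i)\big),$$ where $\hat\nabla$ is the adjoint of the LeJan-Watanabe connection $\breve\nabla$ of $X$. Then $$\bar\delta\phi=-\sum_{i=1}^m i_{X^i}L_{X^i}\phi$$ and $$\sum_{i=1}^mL_{X^i}L_{X^i}\phi=-\bar\delta d\phi-d\bar\delta\phi .$$
   Context: $M$ is a $C^\infty$ manifold. $M$ carries the induced Riemannian metric, for which $X(x)$ restricted to $[\ker X(x)]^\perp$ is an isometry onto $T_xM$; $Y(x):T_xM\to\mathbb{R}^m$ is the adjoint of $X(x)$. The LeJan-Watanabe connection is $\breve\nabla_vZ=X(x)(d[Y(\cdot)Z(\cdot)](v))$, $v\in T_xM$, with torsion $\breve T(U,V)=\breve\nabla_UV-\breve\nabla_VU-[U,V]$, and its adjoint connection is $\hat\nabla_VZ=\breve\nabla_VZ-\breve T(V,Z)$, extended to differential forms in the usual way; $\hat\nabla\phi(X^i)$ denotes the covariant derivative $\hat\nabla_{X^i}\phi$. $i_A\phi$ is the interior product $i_A\phi(v_1,\dots,v_{q-1})=\phi(A,v_1,\dots,v_{q-1})$ (zero on $0$-forms), $L_A$ is Lie differentiation in the direction $A$, and $d$ is exterior differentiation. *)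

theory Defs
  imports "HOL-Analysis.Analysis"
begin

section \<open>Smooth manifolds\<close>

text \<open>The domain \<open>S\<close> is always open below, so that \<open>at x\<close> is the right filter. Being $C^{k+1}$ means
  being differentiable with all directional derivatives $C^k$.\<close>

primrec Ck_on :: "nat \<Rightarrow> 'e::real_normed_vector set \<Rightarrow> ('e \<Rightarrow> 'f::real_normed_vector) \<Rightarrow> bool"
  where
    "Ck_on 0 S f \<longleftrightarrow> continuous_on S f"
  | "Ck_on (Suc k) S f \<longleftrightarrow> (\<forall>x\<in>S. f differentiable (at x)) \<and>
       (\<forall>v. Ck_on k S (\<lambda>x. frechet_derivative f (at x) v))"

definition smooth_on :: "'e::real_normed_vector set \<Rightarrow> ('e \<Rightarrow> 'f::real_normed_vector) \<Rightarrow> bool"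
  where "smooth_on S f \<longleftrightarrow> (\<forall>k. Ck_on k S f)"

text \<open>A chart is its domain together with the coordinate map. The manifold is the whole of the type
  \<open>'a\<close>, which carries its topology (Hausdorff and second countable by the class constraints in the
  theorem), and is modelled on the Euclidean space \<open>'e\<close>.\<close>

type_synonym ('a, 'e) chart = "'a set \<times> ('a \<Rightarrow> 'e)"

definition smooth_atlas :: "('a::topological_space, 'e::euclidean_space) chart set \<Rightarrow> bool"
  where "smooth_atlas \<A> \<longleftrightarrow>
    (\<forall>(U, \<kappa>)\<in>\<A>. open U \<and> open (\<kappa> ` U) \<and> homeomorphism U (\<kappa> ` U) \<kappa> (inv_into U \<kappa>)) \<and>
    (\<Union>(U, \<kappa>)\<in>\<A>. U) = UNIV \<and>
    (\<forall>(U, \<kappa>)\<in>\<A>. \<forall>(U', \<kappa>')\<in>\<A>. smooth_on (\<kappa> ` (U \<inter> U')) (\<kappa>' \<circ> inv_into U \<kappa>))"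

definition smooth_fun_on :: 
    "('a::topological_space, 'e::euclidean_space) chart set \<Rightarrow> 'a set \<Rightarrow> ('a \<Rightarrow> real) \<Rightarrow> bool"
  where "smooth_fun_on \<A> W f \<longleftrightarrow>
    (\<forall>(U, \<kappa>)\<in>\<A>. smooth_on (\<kappa> ` (U \<inter> W)) (f \<circ> inv_into U \<kappa>))"

definition smooth_near ::
    "('a::topological_space, 'e::euclidean_space) chart set \<Rightarrow> 'a \<Rightarrow> ('a \<Rightarrow> real) \<Rightarrow> bool"
  where "smooth_near \<A> x f \<longleftrightarrow> (\<exists>W. open W \<and> x \<in> W \<and> smooth_fun_on \<A> W f)"


section \<open>Tangent vectors and vector fields\<close>

text \<open>A tangent vector at \<open>x\<close> is a derivation on the germs of smooth functions at \<open>x\<close>. It is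
  represented on functions that are smooth near \<open>x\<close> (the Leibniz rule makes it depend only on the
  germ), with value \<open>0\<close> on all other functions so that the representation is unique. The linear
  structure of the tangent space is the pointwise one.\<close>

type_synonym 'a tangent = "('a \<Rightarrow> real) \<Rightarrow> real"

definition tangent_space ::
    "('a::topological_space, 'e::euclidean_space) chart set \<Rightarrow> 'a \<Rightarrow> 'a tangent set"
  where "tangent_space \<A> x = {v.
    (\<forall>f. \<not> smooth_near \<A> x f \<longrightarrow> v f = 0) \<and>
    (\<forall>f g a b. smooth_near \<A> x f \<longrightarrow> smooth_near \<A> x g \<longrightarrow>
       v (\<lambda>y. a * f y + b * g y) = a * v f + b * v g) \<and>
    (\<forall>f g. smooth_near \<A> x f \<longrightarrow> smooth_near \<A> x g \<longrightarrow>
       v (\<lambda>y. f y * g y) = f x * v g + g x * v f)}"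

type_synonym 'a vfield = "'a \<Rightarrow> 'a tangent"

definition smooth_vfield ::
    "('a::topological_space, 'e::euclidean_space) chart set \<Rightarrow> 'a vfield \<Rightarrow> bool"
  where "smooth_vfield \<A> V \<longleftrightarrow>
    (\<forall>x. V x \<in> tangent_space \<A> x) \<and>
    (\<forall>x f. smooth_near \<A> x f \<longrightarrow> smooth_near \<A> x (\<lambda>y. V y f))"

definition bracket ::
    "('a::topological_space, 'e::euclidean_space) chart set \<Rightarrow> 'a vfield \<Rightarrow> 'a vfield \<Rightarrow> 'a vfield"
  where "bracket \<A> U V = (\<lambda>x f.
    if smooth_near \<A> x f then U x (\<lambda>y. V y f) - V x (\<lambda>y. U y f) else 0)"


section \<open>Differential forms\<close>

text \<open>A form takes its arguments as a list, and a \<open>q\<close>-form is \<open>0\<close> on anything that is not a list of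
  \<open>q\<close> tangent vectors at the point in question. The operators below therefore need no degree
  parameter, and equality of forms is equality of functions.\<close>

type_synonym 'a form = "'a \<Rightarrow> 'a tangent list \<Rightarrow> real"

definition smooth_form ::
    "('a::topological_space, 'e::euclidean_space) chart set \<Rightarrow> nat \<Rightarrow> 'a form \<Rightarrow> bool"
  where "smooth_form \<A> q \<phi> \<longleftrightarrow>
    (\<forall>x vs. \<not> (length vs = q \<and> set vs \<subseteq> tangent_space \<A> x) \<longrightarrow> \<phi> x vs = 0) \<and>
    (\<forall>x vs i u w a b. length vs = q \<longrightarrow> set vs \<subseteq> tangent_space \<A> x \<longrightarrow> i < q \<longrightarrow>
       u \<in> tangent_space \<A> x \<longrightarrow> w \<in> tangent_space \<A> x \<longrightarrow>
       \<phi> x (vs[i := (\<lambda>f. a * u f + b * w f)]) = a * \<phi> x (vs[i := u]) + b * \<phi> x (vs[i := w])) \<and>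
    (\<forall>x vs i j. length vs = q \<longrightarrow> set vs \<subseteq> tangent_space \<A> x \<longrightarrow> i < j \<longrightarrow> j < q \<longrightarrow>
       vs ! i = vs ! j \<longrightarrow> \<phi> x vs = 0) \<and>
    (\<forall>Vs. length Vs = q \<longrightarrow> (\<forall>V\<in>set Vs. smooth_vfield \<A> V) \<longrightarrow>
       smooth_fun_on \<A> UNIV (\<lambda>x. \<phi> x (map (\<lambda>V. V x) Vs)))"

text \<open>For an expression \<open>F Vs x\<close> in vector fields \<open>Vs\<close> that is multilinear over the smooth functions,
  the value at \<open>x\<close> depends only on the vectors \<open>V x\<close>; this turns such an expression into a form.\<close>

definition tensorial ::
    "('a::topological_space, 'e::euclidean_space) chart set \<Rightarrow>
     ('a vfield list \<Rightarrow> 'a \<Rightarrow> real) \<Rightarrow> 'a form"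
  where "tensorial \<A> F = (\<lambda>x vs.
    if set vs \<subseteq> tangent_space \<A> x then
      (THE r. \<forall>Vs. (\<forall>V\<in>set Vs. smooth_vfield \<A> V) \<longrightarrow> map (\<lambda>V. V x) Vs = vs \<longrightarrow> F Vs x = r)
    else 0)"

text \<open>On a \<open>0\<close>-form this is \<open>0\<close>, since a \<open>0\<close>-form vanishes on nonempty lists.\<close>

definition interior_product :: "'a vfield \<Rightarrow> 'a form \<Rightarrow> 'a form"
  where "interior_product A \<phi> = (\<lambda>x vs. \<phi> x (A x # vs))"

definition lie_derivative ::
    "('a::topological_space, 'e::euclidean_space) chart set \<Rightarrow> 'a vfield \<Rightarrow> 'a form \<Rightarrow> 'a form"
  where "lie_derivative \<A> A \<phi> = tensorial \<A> (\<lambda>Vs x.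
    A x (\<lambda>y. \<phi> y (map (\<lambda>V. V y) Vs)) -
    (\<Sum>j<length Vs. \<phi> x ((map (\<lambda>V. V x) Vs)[j := bracket \<A> A (Vs ! j) x])))"

text \<open>\<open>nths Vs (- I)\<close> is \<open>Vs\<close> with the entries at the positions in \<open>I\<close> omitted.\<close>

definition ext_derivative ::
    "('a::topological_space, 'e::euclidean_space) chart set \<Rightarrow> 'a form \<Rightarrow> 'a form"
  where "ext_derivative \<A> \<phi> = tensorial \<A> (\<lambda>Vs x.
    (\<Sum>i<length Vs. (-1) ^ i * (Vs ! i) x (\<lambda>y. \<phi> y (map (\<lambda>V. V y) (nths Vs (- {i}))))) +
    (\<Sum>j<length Vs. \<Sum>i<j. (-1) ^ (i + j) *
       \<phi> x (bracket \<A> (Vs ! i) (Vs ! j) x # map (\<lambda>V. V x) (nths Vs (- {i, j})))))"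


section \<open>The LeJan-Watanabe connection and its adjoint\<close>

text \<open>Here \<open>X x\<close> maps $\mathbf{R}^m$ linearly onto the tangent space at \<open>x\<close>. The metric is the one
  for which the restriction of \<open>X x\<close> to the orthogonal complement of its kernel is an isometry.\<close>

definition induced_metric :: "('a \<Rightarrow> real^'m \<Rightarrow> 'a tangent) \<Rightarrow> 'a \<Rightarrow> 'a tangent \<Rightarrow> 'a tangent \<Rightarrow> real"
  where "induced_metric X x u v =
    (let N = {w. X x w = (\<lambda>f. 0)}\<^sup>\<bottom> in inv_into N (X x) u \<bullet> inv_into N (X x) v)"

definition adjoint_map :: "('a \<Rightarrow> real^'m \<Rightarrow> 'a tangent) \<Rightarrow> 'a \<Rightarrow> 'a tangent \<Rightarrow> real^'m"
  where "adjoint_map X x v = (THE w. \<forall>k. w \<bullet> k = induced_metric X x v (X x k))"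

definition LW_connection ::
    "('a \<Rightarrow> real^'m \<Rightarrow> 'a tangent) \<Rightarrow> 'a vfield \<Rightarrow> 'a vfield \<Rightarrow> 'a vfield"
  where "LW_connection X V Z = (\<lambda>x. X x (\<chi> j. V x (\<lambda>y. adjoint_map X y (Z y) $ j)))"

definition LW_torsion ::
    "('a::topological_space, 'e::euclidean_space) chart set \<Rightarrow> ('a \<Rightarrow> real^'m \<Rightarrow> 'a tangent) \<Rightarrow>
     'a vfield \<Rightarrow> 'a vfield \<Rightarrow> 'a vfield"
  where "LW_torsion \<A> X U V = (\<lambda>x f.
    LW_connection X U V x f - LW_connection X V U x f - bracket \<A> U V x f)"

definition adjoint_connection ::
    "('a::topological_space, 'e::euclidean_space) chart set \<Rightarrow> ('a \<Rightarrow> real^'m \<Rightarrow> 'a tangent) \<Rightarrow>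
     'a vfield \<Rightarrow> 'a vfield \<Rightarrow> 'a vfield"
  where "adjoint_connection \<A> X V Z = (\<lambda>x f.
    LW_connection X V Z x f - LW_torsion \<A> X V Z x f)"

definition adjoint_connection_form ::
    "('a::topological_space, 'e::euclidean_space) chart set \<Rightarrow> ('a \<Rightarrow> real^'m \<Rightarrow> 'a tangent) \<Rightarrow>
     'a vfield \<Rightarrow> 'a form \<Rightarrow> 'a form"
  where "adjoint_connection_form \<A> X V \<phi> = tensorial \<A> (\<lambda>Zs x.
    V x (\<lambda>y. \<phi> y (map (\<lambda>Z. Z y) Zs)) -
    (\<Sum>j<length Zs. \<phi> x ((map (\<lambda>Z. Z x) Zs)[j := adjoint_connection \<A> X V (Zs ! j) x])))"

definition bar_delta ::
    "('a::topological_space, 'e::euclidean_space) chart set \<Rightarrow> ('a \<Rightarrow> real^'m \<Rightarrow> 'a tangent) \<Rightarrow>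
     ('m \<Rightarrow> real^'m) \<Rightarrow> 'a form \<Rightarrow> 'a form"
  where "bar_delta \<A> X e \<phi> = (\<lambda>x vs.
    - (\<Sum>i\<in>UNIV. interior_product (\<lambda>y. X y (e i))
         (adjoint_connection_form \<A> X (\<lambda>y. X y (e i)) \<phi>) x vs))"

end

(*
  Let P(x) = Y(x)X(x) be the orthogonal projection of R^m onto the orthogonal complement of ker X(x).
  Along V = X(.)w, the Lie derivative of a form exceeds its adjoint covariant derivative by the sum
  over the slots of the form, a slot Z being replaced by X(x)(dP(Z)w).  Differentiating P P = P gives
  P (dP) P = 0, so this vector vanishes for w orthogonal to ker X(x), while V(x) = 0 for w in
  ker X(x).  The correction terms in bar_delta are therefore traces of bilinear forms B on R^m with
  B(u, v) = B(Pu, v - Pv), and such traces are zero.  The second formula then follows from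
  L_A = i_A d + d i_A and d L_A = L_A d.

  Since Y is smooth (Hadamard's lemma identifies derivations by their values on coordinates, and
  Gram-Schmidt solves the resulting linear system smoothly), every vector field V is the combination
  of the global fields X(.)e_j with the smooth coefficients (Y V)_j; this replaces local frames and
  bump functions in proofs of tensoriality.  Moreover L_A and d satisfy recursions in the first
  argument of a form, so that Cartan's calculus reduces to inductions on the degree.
*)
theory Submission
  imports Defs
begin

section \<open>Calculus of smooth functions\<close>

text \<open>The operators on forms are all given through \<open>tensorial\<close>, a definite
  description that yields nothing until its argument is known to depend only on the values of the
  fields at the point. The calculus is therefore done on the bare expressions \<open>FL\<close>,
  \<open>Fd\<close> and \<open>FA\<close> in lists of vector fields, and passes to forms once
  pointwise dependence is established. The critical case is a field that vanishes at x: it must be a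
  combination of smooth fields whose smooth coefficients also vanish at x. With tangent vectors as
  abstract derivations even the smoothness of Y needs work: X(x)w = v becomes a finite linear system
  only when finitely many functions are known to separate derivations. In the adjoint connection the
  torsion cancels the derivative of Z along V up to the bracket: the LeJan-Watanabe derivative of V
  along Z, plus [V,Z]. So the difference from the Lie derivative is a pointwise endomorphism. Its
  single contributions need not vanish, and e need not be adapted to the kernel of X(x); only the
  sum over the basis is zero.\<close>

lemma Ck_on_subset: "Ck_on k S f \<Longrightarrow> T \<subseteq> S \<Longrightarrow> Ck_on k T f"
  by (induction k arbitrary: f) (auto intro: continuous_on_subset)

lemma frechet_derivative_cong_open:
  assumes "open S" "x \<in> S" "\<And>y. y \<in> S \<Longrightarrow> f y = g y"
  shows "frechet_derivative f (at x) = frechet_derivative g (at x)"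
proof -
  have "(f has_derivative D) (at x) \<longleftrightarrow> (g has_derivative D) (at x)" for D
    using assms has_derivative_transform_within_open[of f D x UNIV S g]
      has_derivative_transform_within_open[of g D x UNIV S f] by auto
  then show ?thesis
    unfolding frechet_derivative_def by simp
qed

lemma differentiable_cong_open:
  assumes "open S" "x \<in> S" "\<And>y. y \<in> S \<Longrightarrow> f y = g y" "f differentiable (at x)"
  shows "g differentiable (at x)"
  using assms has_derivative_transform_within_open[of f _ x UNIV S g]
  unfolding differentiable_def by blast

text \<open>Agreement on an open set makes the derivatives agree at each of its points. The
  induction varies \<open>f\<close> and \<open>g\<close> because its step passes to directional
  derivatives.\<close>

lemma Ck_on_cong:
  assumes "open S" "\<And>y. y \<in> S \<Longrightarrow> f y = g y" "Ck_on k S f"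
  shows "Ck_on k S g"
  using assms(2,3)
proof (induction k arbitrary: f g)
  case 0
  then show ?case by (auto cong: continuous_on_cong)
next
  case (Suc k)
  have "frechet_derivative f (at x) v = frechet_derivative g (at x) v" if "x \<in> S" for x v
    using frechet_derivative_cong_open[OF \<open>open S\<close> that, of f g] Suc.prems(1) by simp
  moreover have "g differentiable (at x)" if "x \<in> S" for x
    using differentiable_cong_open[OF \<open>open S\<close> that, of f g] Suc.prems that by auto
  ultimately show ?case
    using Suc.IH[of "\<lambda>x. frechet_derivative f (at x) _" "\<lambda>x. frechet_derivative g (at x) _"]
      Suc.prems(2) by (metis Ck_on.simps(2))
qed

lemma Ck_on_local:
  assumes "\<And>x. x \<in> S \<Longrightarrow> \<exists>T. open T \<and> x \<in> T \<and> Ck_on k T f"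
  shows "Ck_on k S f"
  using assms
proof (induction k arbitrary: f)
  case 0
  show ?case
    unfolding Ck_on.simps
  proof (rule continuous_at_imp_continuous_on, rule ballI)
    fix x assume "x \<in> S"
    then obtain T where "open T" "x \<in> T" "continuous_on T f"
      using 0 by auto
    then show "isCont f x"
      by (simp add: continuous_on_eq_continuous_at)
  qed
next
  case (Suc k)
  have "f differentiable (at x)" if "x \<in> S" for x
    using Suc.prems[OF that] by auto
  moreover have "Ck_on k S (\<lambda>x. frechet_derivative f (at x) v)" for v
  proof (rule Suc.IH)
    fix x assume "x \<in> S"
    then show "\<exists>T. open T \<and> x \<in> T \<and> Ck_on k T (\<lambda>x. frechet_derivative f (at x) v)"
      using Suc.prems[of x] by auto
  qed
  ultimately show ?case by simp
qed

lemma Ck_on_Suc_imp: "Ck_on (Suc k) S f \<Longrightarrow> Ck_on k S f"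
proof (induction k arbitrary: f)
  case 0
  then show ?case
    by (auto intro!: continuous_at_imp_continuous_on differentiable_imp_continuous_within)
next
  case (Suc k)
  then show ?case by simp
qed

lemma Ck_on_0_imp: "Ck_on k S f \<Longrightarrow> continuous_on S f"
  by (induction k) (use Ck_on_Suc_imp in \<open>auto simp del: Ck_on.simps(2)\<close>)

text \<open>Uniqueness of the derivative lets an explicit formula \<open>D\<close> stand in for
  \<open>frechet_derivative\<close>, so the usual rules of differentiation drive the inductions that
  follow.\<close>

lemma Ck_on_SucI:
  assumes "open S" "\<And>x. x \<in> S \<Longrightarrow> (f has_derivative D x) (at x)" "\<And>v. Ck_on k S (\<lambda>x. D x v)"
  shows "Ck_on (Suc k) S f"
proof -
  have "D x v = frechet_derivative f (at x) v" if "x \<in> S" for x v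
    using frechet_derivative_at[OF assms(2)[OF that]] by simp
  then have "Ck_on k S (\<lambda>x. frechet_derivative f (at x) v)" for v
    by (intro Ck_on_cong[OF assms(1) _ assms(3)[of v]]) simp
  then show ?thesis
    using assms(2) by (auto simp: differentiable_def)
qed

lemma Ck_on_Suc_has_derivative:
  assumes "Ck_on (Suc k) S f" "x \<in> S"
  shows "(f has_derivative frechet_derivative f (at x)) (at x)"
  using assms frechet_derivative_works by auto

lemma Ck_on_const: "open S \<Longrightarrow> Ck_on k S (\<lambda>x. c)"
  by (induction k arbitrary: c) auto

lemma Ck_on_add:
  assumes "open S" "Ck_on k S f" "Ck_on k S g"
  shows "Ck_on k S (\<lambda>x. f x + g x)"
  using assms(2,3)
proof (induction k arbitrary: f g)
  case 0
  then show ?case by (auto intro: continuous_intros)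
next
  case (Suc k)
  show ?case
    by (rule Ck_on_SucI[OF assms(1)
          has_derivative_add[OF Ck_on_Suc_has_derivative[OF Suc.prems(1)]
            Ck_on_Suc_has_derivative[OF Suc.prems(2)]]])
       (use Suc in auto)
qed

lemma Ck_on_mult:
  fixes f g :: "'e::real_normed_vector \<Rightarrow> real"
  assumes "open S" "Ck_on k S f" "Ck_on k S g"
  shows "Ck_on k S (\<lambda>x. f x * g x)"
  using assms(2,3)
proof (induction k arbitrary: f g)
  case 0
  then show ?case by (auto intro: continuous_intros)
next
  case (Suc k)
  show ?case
    by (rule Ck_on_SucI[OF assms(1)
          has_derivative_mult[OF Ck_on_Suc_has_derivative[OF Suc.prems(1)]
            Ck_on_Suc_has_derivative[OF Suc.prems(2)]]])
       (use Suc Ck_on_Suc_imp[OF Suc.prems(1)] Ck_on_Suc_imp[OF Suc.prems(2)]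
         in \<open>auto intro!: Ck_on_add[OF assms(1)] simp del: Ck_on.simps(2)\<close>,
        use Suc in auto)
qed

lemma Ck_on_sum:
  assumes "open S" "\<And>i. i \<in> I \<Longrightarrow> Ck_on k S (f i)"
  shows "Ck_on k S (\<lambda>x. \<Sum>i\<in>I. f i x)"
  using assms(2)
  by (induction I rule: infinite_finite_induct) (auto intro: Ck_on_const Ck_on_add assms(1))

lemma Ck_on_bounded_linear:
  assumes "open S" "bounded_linear L" "Ck_on k S f"
  shows "Ck_on k S (\<lambda>x. L (f x))"
  using assms(3)
proof (induction k arbitrary: f)
  case 0
  then show ?case
    using bounded_linear.continuous_on[OF assms(2)] by auto
next
  case (Suc k)
  show ?case
    by (rule Ck_on_SucI[OF assms(1) bounded_linear.has_derivative[OF assms(2)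
            Ck_on_Suc_has_derivative[OF Suc.prems]]])
       (use Suc in auto)
qed

lemma Ck_on_compose:
  fixes f :: "'e::real_normed_vector \<Rightarrow> 'f::euclidean_space" and g :: "'f \<Rightarrow> real"
  assumes "open S" "open T" "f ` S \<subseteq> T" "Ck_on k S f" "Ck_on k T g"
  shows "Ck_on k S (\<lambda>x. g (f x))"
  using assms(4,5)
proof (induction k arbitrary: g)
  case 0
  then show ?case
    using continuous_on_compose2[of T g S f] assms(3) by auto
next
  case (Suc k)
  \<comment> \<open>The chain rule evaluates the derivative of \<open>g\<close> in a direction that
    moves with x, while \<open>Ck_on\<close> speaks of fixed directions. Expanding the inner
    derivative in \<open>Basis\<close> leaves sums of products of fixed-direction
    derivatives.\<close>
  let ?D = "\<lambda>x v. \<Sum>b\<in>Basis. (frechet_derivative f (at x) v \<bullet> b) * frechet_derivative g (at (f x)) b"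
  have D: "((\<lambda>x. g (f x)) has_derivative ?D x) (at x)" if "x \<in> S" for x
  proof -
    have f: "(f has_derivative frechet_derivative f (at x)) (at x)"
      using Ck_on_Suc_has_derivative[OF Suc.prems(1) that] .
    have g: "(g has_derivative frechet_derivative g (at (f x))) (at (f x))"
      using Ck_on_Suc_has_derivative[OF Suc.prems(2)] that assms(3) by blast
    interpret lg: linear "frechet_derivative g (at (f x))"
      using g has_derivative_linear by blast
    have "frechet_derivative g (at (f x)) w = (\<Sum>b\<in>Basis. (w \<bullet> b) * frechet_derivative g (at (f x)) b)" for w
      by (subst euclidean_representation[of w, symmetric]) (simp only: lg.sum lg.scaleR real_scaleR_def)
    then have "(\<lambda>v. frechet_derivative g (at (f x)) (frechet_derivative f (at x) v)) = ?D x"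
      by blast
    then show ?thesis
      using has_derivative_compose[OF f g] by simp
  qed
  show ?case
  proof (rule Ck_on_SucI[OF assms(1) D])
    fix v
    have "Ck_on k S (\<lambda>x. frechet_derivative f (at x) v \<bullet> b)" for b
      by (rule Ck_on_bounded_linear[OF assms(1) bounded_linear_inner_left]) (use Suc.prems(1) in auto)
    moreover have "Ck_on k S (\<lambda>x. frechet_derivative g (at (f x)) b)" for b
      using Suc.IH[of "\<lambda>y. frechet_derivative g (at y) b"] Suc.prems Ck_on_Suc_imp by auto
    ultimately show "Ck_on k S (\<lambda>x. ?D x v)"
      by (intro Ck_on_sum Ck_on_mult assms(1))
  qed
qed

text \<open>The derivative is a polynomial in \<open>inverse\<close> itself, so order k yields order
  k + 1.\<close>

lemma Ck_on_inverse: "Ck_on k (- {0::real}) inverse"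
proof (induction k)
  case 0
  then show ?case by (auto intro!: continuous_intros)
next
  case (Suc k)
  have op: "open (- {0::real})" by auto
  show ?case
  proof (rule Ck_on_SucI[OF op])
    show "(inverse has_derivative (\<lambda>h. (-1) * (inverse x * h * inverse x))) (at x)" if "x \<in> - {0}" for x :: real
      using has_derivative_inverse'[of x UNIV] that by simp
    show "Ck_on k (- {0}) (\<lambda>x::real. (-1) * (inverse x * v * inverse x))" for v
      by (intro Ck_on_mult[OF op] Ck_on_const[OF op] Suc)
  qed
qed

lemma smooth_on_cong: "open S \<Longrightarrow> (\<And>y. y \<in> S \<Longrightarrow> f y = g y) \<Longrightarrow> smooth_on S f \<Longrightarrow> smooth_on S g"
  unfolding smooth_on_def using Ck_on_cong by metis

lemma smooth_on_subset: "smooth_on S f \<Longrightarrow> T \<subseteq> S \<Longrightarrow> smooth_on T f"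
  unfolding smooth_on_def using Ck_on_subset by metis

lemma smooth_on_frechet_derivative: "smooth_on S f \<Longrightarrow> smooth_on S (\<lambda>x. frechet_derivative f (at x) v)"
  unfolding smooth_on_def by (metis Ck_on.simps(2))

lemma smooth_on_has_derivative:
  "smooth_on S f \<Longrightarrow> x \<in> S \<Longrightarrow> (f has_derivative frechet_derivative f (at x)) (at x)"
  unfolding smooth_on_def using Ck_on_Suc_has_derivative by blast

lemma smooth_on_continuous: "smooth_on S f \<Longrightarrow> continuous_on S f"
  unfolding smooth_on_def using Ck_on.simps(1) by blast

lemma smooth_on_const: "open S \<Longrightarrow> smooth_on S (\<lambda>x. c)"
  by (simp add: smooth_on_def Ck_on_const)

lemma smooth_on_add: "open S \<Longrightarrow> smooth_on S f \<Longrightarrow> smooth_on S g \<Longrightarrow> smooth_on S (\<lambda>x. f x + g x)"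
  by (simp add: smooth_on_def Ck_on_add)

lemma smooth_on_mult:
  fixes f g :: "'e::real_normed_vector \<Rightarrow> real"
  shows "open S \<Longrightarrow> smooth_on S f \<Longrightarrow> smooth_on S g \<Longrightarrow> smooth_on S (\<lambda>x. f x * g x)"
  by (simp add: smooth_on_def Ck_on_mult)

lemma smooth_on_bounded_linear:
  "open S \<Longrightarrow> bounded_linear L \<Longrightarrow> smooth_on S f \<Longrightarrow> smooth_on S (\<lambda>x. L (f x))"
  by (simp add: smooth_on_def Ck_on_bounded_linear)

lemma smooth_on_ident: "open S \<Longrightarrow> smooth_on S (\<lambda>x. x)"
  unfolding smooth_on_def
proof
  fix k assume "open S"
  then show "Ck_on k S (\<lambda>x. x)"
    by (cases k) (auto intro: Ck_on_const)
qed

lemma smooth_on_compose: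
  fixes f :: "'e::real_normed_vector \<Rightarrow> 'f::euclidean_space" and g :: "'f \<Rightarrow> real"
  shows "open S \<Longrightarrow> open T \<Longrightarrow> f ` S \<subseteq> T \<Longrightarrow> smooth_on S f \<Longrightarrow> smooth_on T g
    \<Longrightarrow> smooth_on S (\<lambda>x. g (f x))"
  by (simp add: smooth_on_def Ck_on_compose)

lemma smooth_on_inverse:
  fixes f :: "'e::real_normed_vector \<Rightarrow> real"
  assumes "open S" "smooth_on S f" "\<And>x. x \<in> S \<Longrightarrow> f x \<noteq> 0"
  shows "smooth_on S (\<lambda>x. inverse (f x))"
  by (rule smooth_on_compose[of S "- {0}" f inverse])
     (use assms Ck_on_inverse in \<open>auto simp: smooth_on_def\<close>)


subsection \<open>Hadamard's lemma\<close>

lemma ball_segment: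
  fixes p :: "'e::real_normed_vector"
  assumes "z \<in> ball p r" "0 \<le> t" "t \<le> 1"
  shows "p + t *\<^sub>R (z - p) \<in> ball p r"
proof -
  have "norm (t *\<^sub>R (z - p)) \<le> norm (z - p)"
    using assms by (simp add: mult_left_le_one_le)
  then show ?thesis
    using assms(1) by (simp add: dist_norm norm_minus_commute)
qed

lemma continuous_on_segment:
  fixes p :: "'e::real_normed_vector"
  assumes "continuous_on (ball p r) h"
  shows "continuous_on (ball p r \<times> cbox 0 (1::real)) (\<lambda>(z, t). h (p + t *\<^sub>R (z - p)))"
proof -
  have "continuous_on (ball p r \<times> cbox 0 (1::real)) (\<lambda>x. h (p + snd x *\<^sub>R (fst x - p)))"
    by (rule continuous_on_compose2[OF assms])
       (auto intro!: continuous_intros simp del: mem_ball intro: ball_segment)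
  then show ?thesis
    by (simp add: split_beta)
qed

text \<open>Every derivative in z brings out a factor t by the chain rule along the segment;
  allowing an arbitrary weight \<open>t ^ j\<close> is what makes the claim inductive.\<close>

lemma Ck_on_segment_integral:
  fixes p :: "'e::euclidean_space" and h :: "'e \<Rightarrow> real"
  assumes "Ck_on k (ball p r) h"
  shows "Ck_on k (ball p r) (\<lambda>z. integral (cbox 0 1) (\<lambda>t. t ^ j * h (p + t *\<^sub>R (z - p))))"
  using assms
proof (induction k arbitrary: h j)
  case 0
  then have c: "continuous_on (ball p r) h" by simp
  have "continuous_on (ball p r \<times> cbox 0 (1::real)) (\<lambda>x. snd x ^ j * (case x of (z, t) \<Rightarrow> h (p + t *\<^sub>R (z - p))))"
    by (intro continuous_intros continuous_on_segment c)
  then have "continuous_on (ball p r \<times> cbox 0 (1::real)) (\<lambda>(z, t). t ^ j * h (p + t *\<^sub>R (z - p)))"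
    by (simp add: split_beta)
  then show ?case
    unfolding Ck_on.simps by (rule integral_continuous_on_param)
next
  case (Suc k)
  let ?B = "ball p r"
  let ?D = "\<lambda>z. frechet_derivative h (at z)"
  have hD: "(h has_derivative ?D z) (at z)" if "z \<in> ?B" for z
    using Ck_on_Suc_has_derivative[OF Suc.prems that] .
  have cont: "continuous_on ?B (\<lambda>z. ?D z v)" for v
    by (rule Ck_on_0_imp[of k]) (use Suc.prems in auto)
  \<comment> \<open>The Leibniz rule for parameter integrals wants the derivative as a bounded
    linear map. \<open>Blinfun\<close> is meaningful only where \<open>h\<close> is differentiable,
    so the facts about \<open>fx\<close> are confined to the ball.\<close>
  define fx where "fx = (\<lambda>z t. t ^ Suc j *\<^sub>R Blinfun (?D (p + t *\<^sub>R (z - p))))"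
  have blf: "blinfun_apply (Blinfun (?D z)) = ?D z" if "z \<in> ?B" for z
    using hD[OF that] has_derivative_bounded_linear bounded_linear_Blinfun_apply by blast
  have fx: "blinfun_apply (fx z t) v = t ^ Suc j * ?D (p + t *\<^sub>R (z - p)) v"
    if "z \<in> ?B" "t \<in> cbox 0 1" for z t v
    using blf[of "p + t *\<^sub>R (z - p)"] ball_segment[of z p r t] that
    by (simp add: fx_def scaleR_blinfun.rep_eq)
  have der: "((\<lambda>z. t ^ j * h (p + t *\<^sub>R (z - p))) has_derivative blinfun_apply (fx z t)) (at z within ?B)"
    if "z \<in> ?B" "t \<in> cbox 0 1" for z t
  proof -
    have "p + t *\<^sub>R (z - p) \<in> ?B"
      using that by (auto simp del: mem_ball intro: ball_segment)
    moreover have "((\<lambda>z. p + t *\<^sub>R (z - p)) has_derivative (\<lambda>v. t *\<^sub>R v)) (at z)"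
      by (auto intro!: derivative_eq_intros simp: algebra_simps)
    ultimately have h': "((\<lambda>z. h (p + t *\<^sub>R (z - p))) has_derivative
        (\<lambda>v. ?D (p + t *\<^sub>R (z - p)) (t *\<^sub>R v))) (at z)"
      using has_derivative_compose[OF _ hD] by blast
    interpret lD: linear "?D (p + t *\<^sub>R (z - p))"
      using hD has_derivative_linear \<open>p + t *\<^sub>R (z - p) \<in> ?B\<close> by blast
    have "((\<lambda>z. t ^ j * h (p + t *\<^sub>R (z - p))) has_derivative
        (\<lambda>v. t ^ j * ?D (p + t *\<^sub>R (z - p)) (t *\<^sub>R v))) (at z)"
      using has_derivative_mult_right[OF h'] .
    moreover have "(\<lambda>v. t ^ j * ?D (p + t *\<^sub>R (z - p)) (t *\<^sub>R v)) = blinfun_apply (fx z t)"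
      using fx[OF that] by (auto simp: lD.scaleR)
    ultimately show ?thesis
      using has_derivative_at_withinI by auto
  qed
  \<comment> \<open>In finite dimension continuity into the bounded linear maps can be tested on
    basis vectors, where only a directional derivative remains.\<close>
  have cfx: "continuous_on (?B \<times> cbox 0 1) (\<lambda>(z, t). fx z t)"
  proof (rule continuous_on_blinfun_componentwise)
    fix b :: 'e
    have "continuous_on (?B \<times> cbox 0 (1::real)) (\<lambda>x. snd x ^ Suc j * (case x of (z, t) \<Rightarrow> ?D (p + t *\<^sub>R (z - p)) b))"
      by (intro continuous_intros continuous_on_segment cont)
    then show "continuous_on (?B \<times> cbox 0 1) (\<lambda>x. blinfun_apply (case x of (z, t) \<Rightarrow> fx z t) b)"
      by (rule continuous_on_eq) (use fx in auto)
  qed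
  have cz: "continuous_on (cbox 0 1) (\<lambda>t. h (p + t *\<^sub>R (z - p)))" if "z \<in> ?B" for z
  proof -
    have "continuous_on ?B h" using Suc.prems Ck_on_0_imp by blast
    then show ?thesis
      by (rule continuous_on_compose2)
         (use that in \<open>auto intro!: continuous_intros simp del: mem_ball intro: ball_segment\<close>)
  qed
  have int: "(\<lambda>t. t ^ j * h (p + t *\<^sub>R (z - p))) integrable_on cbox 0 1" if "z \<in> ?B" for z
    by (intro integrable_continuous continuous_intros cz that)
  show ?case
  proof (rule Ck_on_SucI[where D = "\<lambda>z. blinfun_apply (integral (cbox 0 1) (fx z))"])
    show "open ?B" by simp
    fix z assume z: "z \<in> ?B"
    show "((\<lambda>z. integral (cbox 0 1) (\<lambda>t. t ^ j * h (p + t *\<^sub>R (z - p)))) has_derivative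
        blinfun_apply (integral (cbox 0 1) (fx z))) (at z)"
      using leibniz_rule[OF der int cfx z convex_ball] z by (simp add: at_within_open[OF z open_ball])
  next
    fix v
    have "blinfun_apply (integral (cbox 0 1) (fx z)) v
        = integral (cbox 0 1) (\<lambda>t. t ^ Suc j * ?D (p + t *\<^sub>R (z - p)) v)" if z: "z \<in> ?B" for z
    proof -
      have "continuous_on (cbox 0 1) (\<lambda>t. case (z, t) of (z, t) \<Rightarrow> fx z t)"
        by (rule continuous_on_compose2[OF cfx]) (use z in \<open>auto intro!: continuous_intros\<close>)
      then have "continuous_on (cbox 0 1) (fx z)"
        by simp
      then have "fx z integrable_on cbox 0 1"
        by (rule integrable_continuous)
      then have "blinfun_apply (integral (cbox 0 1) (fx z)) v = integral (cbox 0 1) (\<lambda>t. blinfun_apply (fx z t) v)"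
        using integral_linear[of "fx z" "cbox 0 1" "\<lambda>F. blinfun_apply F v"]
        by (simp add: o_def bounded_linear_blinfun_apply blinfun.bounded_linear_left)
      also have "\<dots> = integral (cbox 0 1) (\<lambda>t. t ^ Suc j * ?D (p + t *\<^sub>R (z - p)) v)"
        by (rule integral_cong) (use fx[OF z] in auto)
      finally show ?thesis .
    qed
    moreover have "Ck_on k ?B (\<lambda>z. integral (cbox 0 1) (\<lambda>t. t ^ Suc j * ?D (p + t *\<^sub>R (z - p)) v))"
      using Suc.IH[of "\<lambda>z. ?D z v" "Suc j"] Suc.prems by auto
    ultimately show "Ck_on k ?B (\<lambda>z. blinfun_apply (integral (cbox 0 1) (fx z)) v)"
      using Ck_on_cong[of ?B "\<lambda>z. integral (cbox 0 1) (\<lambda>t. t ^ Suc j * ?D (p + t *\<^sub>R (z - p)) v)"] by auto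
  qed
qed

text \<open>Integrate dF along the segment from p to z: \<open>G b\<close> is the mean of the
  partial derivative in direction b over that segment, smooth by the preceding lemma with weight
  \<open>t ^ 0\<close>.\<close>

lemma hadamard:
  fixes p :: "'e::euclidean_space" and F :: "'e \<Rightarrow> real"
  assumes F: "smooth_on (ball p r) F"
  obtains G where "\<And>b. smooth_on (ball p r) (G b)"
    "\<And>z. z \<in> ball p r \<Longrightarrow> F z = F p + (\<Sum>b\<in>Basis. ((z - p) \<bullet> b) * G b z)"
proof
  let ?D = "\<lambda>z. frechet_derivative F (at z)"
  let ?G = "\<lambda>b z. integral (cbox 0 1) (\<lambda>t. t ^ 0 * ?D (p + t *\<^sub>R (z - p)) b)"
  show "smooth_on (ball p r) (?G b)" for b
    using smooth_on_frechet_derivative[OF F, of b] Ck_on_segment_integral unfolding smooth_on_def by blast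
  fix z assume z: "z \<in> ball p r"
  have lin: "linear (?D (p + t *\<^sub>R (z - p)))" and
    FD: "(F has_derivative ?D (p + t *\<^sub>R (z - p))) (at (p + t *\<^sub>R (z - p)))" if "t \<in> cbox 0 1" for t
    using smooth_on_has_derivative[OF F ball_segment[OF z]] that has_derivative_linear by auto
  have cont: "continuous_on (cbox 0 1) (\<lambda>t. ?D (p + t *\<^sub>R (z - p)) b)" for b
    by (rule continuous_on_compose2[OF smooth_on_continuous[OF smooth_on_frechet_derivative[OF F]]])
       (use z in \<open>auto intro!: continuous_intros simp del: mem_ball intro: ball_segment\<close>)
  have rep: "?D (p + t *\<^sub>R (z - p)) (z - p) = (\<Sum>b\<in>Basis. ((z - p) \<bullet> b) * ?D (p + t *\<^sub>R (z - p)) b)"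
    if "t \<in> cbox 0 1" for t
  proof -
    interpret lg: linear "?D (p + t *\<^sub>R (z - p))" using lin that .
    have "?D (p + t *\<^sub>R (z - p)) w = (\<Sum>b\<in>Basis. (w \<bullet> b) * ?D (p + t *\<^sub>R (z - p)) b)" for w
      by (subst euclidean_representation[of w, symmetric]) (simp only: lg.sum lg.scaleR real_scaleR_def)
    then show ?thesis by blast
  qed
  have "((\<lambda>t. ?D (p + t *\<^sub>R (z - p)) (z - p)) has_integral
      F (p + 1 *\<^sub>R (z - p)) - F (p + 0 *\<^sub>R (z - p))) {0..1}"
  proof (rule fundamental_theorem_of_calculus)
    fix t :: real assume "t \<in> {0..1}"
    then have t: "t \<in> cbox 0 1" by simp
    have "((\<lambda>t. p + t *\<^sub>R (z - p)) has_derivative (\<lambda>s. s *\<^sub>R (z - p))) (at t)"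
      by (auto intro!: derivative_eq_intros)
    from has_derivative_compose[OF this FD[OF t]]
    have "((\<lambda>t. F (p + t *\<^sub>R (z - p))) has_derivative (\<lambda>s. s *\<^sub>R ?D (p + t *\<^sub>R (z - p)) (z - p))) (at t)"
      using linear_scale[OF lin[OF t]] by simp
    then show "((\<lambda>t. F (p + t *\<^sub>R (z - p))) has_vector_derivative ?D (p + t *\<^sub>R (z - p)) (z - p)) (at t within {0..1})"
      using has_vector_derivative_def has_vector_derivative_at_within by blast
  qed simp
  then have "F z - F p = integral (cbox 0 1) (\<lambda>t. ?D (p + t *\<^sub>R (z - p)) (z - p))"
    by (simp add: integral_unique)
  also have "\<dots> = integral (cbox 0 1) (\<lambda>t. \<Sum>b\<in>Basis. ((z - p) \<bullet> b) * ?D (p + t *\<^sub>R (z - p)) b)"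
    by (rule integral_cong) (rule rep)
  also have "\<dots> = (\<Sum>b\<in>Basis. integral (cbox 0 1) (\<lambda>t. ((z - p) \<bullet> b) * ?D (p + t *\<^sub>R (z - p)) b))"
    by (rule integral_sum) (auto intro!: integrable_continuous_interval continuous_intros cont[simplified])
  also have "\<dots> = (\<Sum>b\<in>Basis. ((z - p) \<bullet> b) * ?G b z)"
    by simp
  finally show "F z = F p + (\<Sum>b\<in>Basis. ((z - p) \<bullet> b) * ?G b z)"
    by simp
qed


section \<open>Germs of smooth functions and tangent vectors\<close>

locale smooth_manifold =
  fixes \<A> :: "('a::topological_space, 'e::euclidean_space) chart set"
  assumes atlas: "smooth_atlas \<A>"
begin

abbreviation smooth_at :: "'a \<Rightarrow> ('a \<Rightarrow> real) \<Rightarrow> bool"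
  where "smooth_at \<equiv> smooth_near \<A>"

abbreviation T :: "'a \<Rightarrow> 'a tangent set"
  where "T \<equiv> tangent_space \<A>"

lemma chart_open: "(U, \<kappa>) \<in> \<A> \<Longrightarrow> open U"
  and chart_image_open: "(U, \<kappa>) \<in> \<A> \<Longrightarrow> open (\<kappa> ` U)"
  and chart_homeomorphism: "(U, \<kappa>) \<in> \<A> \<Longrightarrow> homeomorphism U (\<kappa> ` U) \<kappa> (inv_into U \<kappa>)"
  using atlas unfolding smooth_atlas_def by auto

lemma chart_cover: obtains U \<kappa> where "(U, \<kappa>) \<in> \<A>" "x \<in> U"
  using atlas unfolding smooth_atlas_def by blast

lemma chart_transition:
  "(U, \<kappa>) \<in> \<A> \<Longrightarrow> (U', \<kappa>') \<in> \<A> \<Longrightarrow> smooth_on (\<kappa> ` (U \<inter> U')) (\<kappa>' \<circ> inv_into U \<kappa>)"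
  using atlas unfolding smooth_atlas_def by fast

lemma chart_inv [simp]: "(U, \<kappa>) \<in> \<A> \<Longrightarrow> y \<in> U \<Longrightarrow> inv_into U \<kappa> (\<kappa> y) = y"
  using chart_homeomorphism homeomorphism_apply1 by metis

lemma chart_open_image:
  assumes "(U, \<kappa>) \<in> \<A>" "open W"
  shows "open (\<kappa> ` (U \<inter> W))"
proof -
  have "openin (top_of_set U) (U \<inter> W)"
    using assms(2) by auto
  then have "openin (top_of_set (\<kappa> ` U)) (\<kappa> ` (U \<inter> W))"
    using homeomorphism_imp_open_map[OF chart_homeomorphism[OF assms(1)]] by blast
  then show ?thesis
    using chart_image_open[OF assms(1)] openin_open_trans by blast
qed

lemma chart_open_preimage:
  assumes "(U, \<kappa>) \<in> \<A>" "open S"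
  shows "open (U \<inter> \<kappa> -` S)"
  using chart_homeomorphism[OF assms(1)] chart_open[OF assms(1)] assms(2)
  by (meson continuous_on_open_vimage homeomorphism_cont1 continuous_open_preimage)

section \<open>Functions smooth near a point\<close>

lemma smooth_fun_onD:
  "smooth_fun_on \<A> W f \<Longrightarrow> (U, \<kappa>) \<in> \<A> \<Longrightarrow> smooth_on (\<kappa> ` (U \<inter> W)) (f \<circ> inv_into U \<kappa>)"
  unfolding smooth_fun_on_def by fast

lemma smooth_fun_on_subset: "smooth_fun_on \<A> W f \<Longrightarrow> W' \<subseteq> W \<Longrightarrow> smooth_fun_on \<A> W' f"
  unfolding smooth_fun_on_def by (blast intro: smooth_on_subset image_mono Int_mono)

lemma smooth_fun_on_cong:
  assumes "open W" "\<And>y. y \<in> W \<Longrightarrow> f y = g y" "smooth_fun_on \<A> W f"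
  shows "smooth_fun_on \<A> W g"
proof -
  have "smooth_on (\<kappa> ` (U \<inter> W)) (g \<circ> inv_into U \<kappa>)" if "(U, \<kappa>) \<in> \<A>" for U \<kappa>
    by (rule smooth_on_cong[of _ "f \<circ> inv_into U \<kappa>"])
       (use assms that in \<open>auto simp: smooth_fun_on_def chart_open_image\<close>)
  then show ?thesis
    by (auto simp: smooth_fun_on_def)
qed

lemma smooth_at_cong:
  assumes "open W" "x \<in> W" "\<And>y. y \<in> W \<Longrightarrow> f y = g y" "smooth_at x f"
  shows "smooth_at x g"
proof -
  obtain W' where "open W'" "x \<in> W'" "smooth_fun_on \<A> W' f"
    using assms(4) unfolding smooth_near_def by blast
  then show ?thesis
    using assms(1-3) smooth_fun_on_cong[of "W \<inter> W'" f g] smooth_fun_on_subset[of W' f "W \<inter> W'"]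
    unfolding smooth_near_def by (metis IntD1 IntI Int_lower2 open_Int)
qed

lemma smooth_at_open:
  "smooth_at x f \<Longrightarrow> \<exists>W. open W \<and> x \<in> W \<and> (\<forall>y\<in>W. smooth_at y f)"
  unfolding smooth_near_def by blast

lemma smooth_at_binary:
  assumes "smooth_at x f" "smooth_at x g"
    and "\<And>S f g :: 'e \<Rightarrow> real. open S \<Longrightarrow> smooth_on S f \<Longrightarrow> smooth_on S g \<Longrightarrow> smooth_on S (\<lambda>z. h (f z) (g z))"
  shows "smooth_at x (\<lambda>y. h (f y) (g y))"
proof -
  obtain W W' where W: "open W" "x \<in> W" "smooth_fun_on \<A> W f" "open W'" "x \<in> W'" "smooth_fun_on \<A> W' g"
    using assms(1,2) unfolding smooth_near_def by blast
  have "smooth_on (\<kappa> ` (U \<inter> (W \<inter> W'))) (\<lambda>z. h ((f \<circ> inv_into U \<kappa>) z) ((g \<circ> inv_into U \<kappa>) z))"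
    if "(U, \<kappa>) \<in> \<A>" for U \<kappa>
    by (rule assms(3)[OF chart_open_image[OF that] smooth_fun_onD smooth_fun_onD])
       (use W that in \<open>auto intro: smooth_fun_on_subset\<close>)
  then have "smooth_fun_on \<A> (W \<inter> W') (\<lambda>y. h (f y) (g y))"
    by (auto simp: smooth_fun_on_def o_def)
  then show ?thesis
    using W unfolding smooth_near_def by blast
qed

lemma smooth_at_add: "smooth_at x f \<Longrightarrow> smooth_at x g \<Longrightarrow> smooth_at x (\<lambda>y. f y + g y)"
  by (rule smooth_at_binary[where h = "(+)"]) (auto intro: smooth_on_add)

lemma smooth_at_mult: "smooth_at x f \<Longrightarrow> smooth_at x g \<Longrightarrow> smooth_at x (\<lambda>y. f y * g y)"
  by (rule smooth_at_binary[where h = "(*)"]) (auto intro: smooth_on_mult)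

lemma smooth_at_const: "smooth_at x (\<lambda>y. c)"
  unfolding smooth_near_def smooth_fun_on_def
  by (rule exI[of _ UNIV]) (auto simp: o_def intro!: smooth_on_const chart_image_open)

lemma smooth_at_sum: "(\<And>i. i \<in> I \<Longrightarrow> smooth_at x (f i)) \<Longrightarrow> smooth_at x (\<lambda>y. \<Sum>i\<in>I. f i y)"
  by (induction I rule: infinite_finite_induct) (auto intro: smooth_at_const smooth_at_add)

lemma smooth_at_diff: "smooth_at x f \<Longrightarrow> smooth_at x g \<Longrightarrow> smooth_at x (\<lambda>y. f y - g y)"
  using smooth_at_add[of x f "\<lambda>y. (-1) * g y"] smooth_at_mult[OF smooth_at_const[of x "-1"], of g] by simp

lemma smooth_at_combination:
  "smooth_at x f \<Longrightarrow> smooth_at x g \<Longrightarrow> smooth_at x (\<lambda>y. a * f y + b * g y)"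
  by (intro smooth_at_add smooth_at_mult smooth_at_const)

text \<open>Turns the global smoothness demanded of forms into a condition on germs, which is how it
  is checked from here on.\<close>

lemma smooth_fun_on_UNIV_iff: "smooth_fun_on \<A> UNIV f \<longleftrightarrow> (\<forall>x. smooth_at x f)"
proof
  assume "smooth_fun_on \<A> UNIV f"
  then show "\<forall>x. smooth_at x f"
    unfolding smooth_near_def by blast
next
  assume sm: "\<forall>x. smooth_at x f"
  have "smooth_on (\<kappa> ` U) (f \<circ> inv_into U \<kappa>)" if U: "(U, \<kappa>) \<in> \<A>" for U \<kappa>
    unfolding smooth_on_def
  proof (intro allI Ck_on_local)
    fix k z assume "z \<in> \<kappa> ` U"
    then obtain y where y: "y \<in> U" "z = \<kappa> y" by blast
    obtain W where W: "open W" "y \<in> W" "smooth_fun_on \<A> W f"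
      using sm unfolding smooth_near_def by blast
    then have "smooth_on (\<kappa> ` (U \<inter> W)) (f \<circ> inv_into U \<kappa>)"
      using U by (auto simp: smooth_fun_on_def)
    then show "\<exists>S. open S \<and> z \<in> S \<and> Ck_on k S (f \<circ> inv_into U \<kappa>)"
      using chart_open_image[OF U W(1)] y W(2) unfolding smooth_on_def by blast
  qed
  then show "smooth_fun_on \<A> UNIV f"
    by (auto simp: smooth_fun_on_def)
qed

text \<open>One chart suffices: in any other chart the representative is the given one composed with
  a smooth transition map.\<close>

lemma smooth_at_chartI:
  assumes U: "(U, \<kappa>) \<in> \<A>" "x \<in> U" and S: "open S" "\<kappa> x \<in> S" "S \<subseteq> \<kappa> ` U"
    and f: "smooth_on S (f \<circ> inv_into U \<kappa>)"
  shows "smooth_at x f"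
proof -
  define W where "W = U \<inter> \<kappa> -` S"
  have "open W"
    unfolding W_def using chart_open_preimage[OF U(1) S(1)] .
  moreover have "smooth_on (\<kappa>' ` (U' \<inter> W)) (f \<circ> inv_into U' \<kappa>')" if U': "(U', \<kappa>') \<in> \<A>" for U' \<kappa>'
  proof (rule smooth_on_cong)
    show op: "open (\<kappa>' ` (U' \<inter> W))"
      using chart_open_image[OF U' \<open>open W\<close>] .
    have "smooth_on (\<kappa>' ` (U' \<inter> W)) (\<kappa> \<circ> inv_into U' \<kappa>')"
      by (rule smooth_on_subset[OF chart_transition[OF U' U(1)]]) (auto simp: W_def)
    then show "smooth_on (\<kappa>' ` (U' \<inter> W)) (\<lambda>z. (f \<circ> inv_into U \<kappa>) ((\<kappa> \<circ> inv_into U' \<kappa>') z))"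
      by (rule smooth_on_compose[OF op S(1) _ _ f, rotated]) (use U' in \<open>auto simp: W_def\<close>)
    show "(f \<circ> inv_into U \<kappa>) ((\<kappa> \<circ> inv_into U' \<kappa>') z) = (f \<circ> inv_into U' \<kappa>') z"
      if "z \<in> \<kappa>' ` (U' \<inter> W)" for z
      using that U' U(1) by (auto simp: W_def)
  qed
  ultimately show ?thesis
    using U(2) S(2) unfolding smooth_near_def smooth_fun_on_def W_def by blast
qed

text \<open>Shrinks to a ball about the image point, the domain required by Hadamard's
  lemma.\<close>

lemma smooth_at_chartE:
  assumes U: "(U, \<kappa>) \<in> \<A>" "x \<in> U" and f: "smooth_at x f"
  obtains r where "r > 0" "ball (\<kappa> x) r \<subseteq> \<kappa> ` U" "smooth_on (ball (\<kappa> x) r) (f \<circ> inv_into U \<kappa>)"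
proof -
  obtain W where W: "open W" "x \<in> W" "smooth_fun_on \<A> W f"
    using f unfolding smooth_near_def by blast
  then have "smooth_on (\<kappa> ` (U \<inter> W)) (f \<circ> inv_into U \<kappa>)"
    using U by (auto simp: smooth_fun_on_def)
  moreover obtain r where "r > 0" "ball (\<kappa> x) r \<subseteq> \<kappa> ` (U \<inter> W)"
    using chart_open_image[OF U(1) W(1)] U(2) W(2) open_contains_ball by blast
  ultimately show thesis
    using that[of r] smooth_on_subset by blast
qed

lemma smooth_at_inverse:
  assumes "smooth_at x f" "f x \<noteq> 0"
  shows "smooth_at x (\<lambda>y. inverse (f y))"
proof -
  obtain U \<kappa> where U: "(U, \<kappa>) \<in> \<A>" "x \<in> U"
    using chart_cover by blast
  obtain r where r: "r > 0" "ball (\<kappa> x) r \<subseteq> \<kappa> ` U" "smooth_on (ball (\<kappa> x) r) (f \<circ> inv_into U \<kappa>)"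
    using smooth_at_chartE[OF U assms(1)] .
  let ?F = "f \<circ> inv_into U \<kappa>"
  \<comment> \<open>\<open>f\<close> is assumed nonzero at \<open>x\<close> only; continuity of its
    chart representative spreads this to a neighbourhood.\<close>
  define S where "S = ball (\<kappa> x) r \<inter> ?F -` (- {0})"
  have "open S"
    unfolding S_def using smooth_on_continuous[OF r(3)] by (intro continuous_open_preimage) auto
  show ?thesis
  proof (rule smooth_at_chartI[OF U \<open>open S\<close>])
    show "smooth_on S ((\<lambda>y. inverse (f y)) \<circ> inv_into U \<kappa>)"
      using smooth_on_inverse[OF \<open>open S\<close> smooth_on_subset[OF r(3)]] by (simp add: S_def o_def)
  qed (use assms(2) U r in \<open>auto simp: S_def\<close>)
qed

lemma smooth_at_coordinate:
  assumes U: "(U, \<kappa>) \<in> \<A>" "x \<in> U"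
  shows "smooth_at x (\<lambda>y. \<kappa> y \<bullet> b)"
proof (rule smooth_at_chartI[OF U chart_image_open[OF U(1)]])
  have sm: "smooth_on (\<kappa> ` U) (\<lambda>z. z \<bullet> b)"
    using smooth_on_bounded_linear[OF _ bounded_linear_inner_left smooth_on_ident] chart_image_open[OF U(1)]
    by blast
  show "smooth_on (\<kappa> ` U) ((\<lambda>y. \<kappa> y \<bullet> b) \<circ> inv_into U \<kappa>)"
    by (rule smooth_on_cong[OF chart_image_open[OF U(1)] _ sm]) (use U in auto)
qed (use U in auto)

section \<open>Derivations at a point\<close>

lemma tangent_combination:
  "u \<in> T x \<Longrightarrow> v \<in> T x \<Longrightarrow> (\<lambda>f. a * u f + b * v f) \<in> T x"
  unfolding tangent_space_def by (simp add: algebra_simps)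

lemma tangent_zero: "(\<lambda>f. 0) \<in> T x"
  unfolding tangent_space_def by simp

lemma tangent_not_smooth: "v \<in> T x \<Longrightarrow> \<not> smooth_at x f \<Longrightarrow> v f = 0"
  unfolding tangent_space_def by blast

lemma tangent_linear:
  "v \<in> T x \<Longrightarrow> smooth_at x f \<Longrightarrow> smooth_at x g \<Longrightarrow> v (\<lambda>y. a * f y + b * g y) = a * v f + b * v g"
  unfolding tangent_space_def by blast

lemma tangent_mult:
  "v \<in> T x \<Longrightarrow> smooth_at x f \<Longrightarrow> smooth_at x g \<Longrightarrow> v (\<lambda>y. f y * g y) = f x * v g + g x * v f"
  unfolding tangent_space_def by blast

lemma tangent_add:
  "v \<in> T x \<Longrightarrow> smooth_at x f \<Longrightarrow> smooth_at x g \<Longrightarrow> v (\<lambda>y. f y + g y) = v f + v g"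
  using tangent_linear[of v x f g 1 1] by simp

lemma tangent_diff:
  "v \<in> T x \<Longrightarrow> smooth_at x f \<Longrightarrow> smooth_at x g \<Longrightarrow> v (\<lambda>y. f y - g y) = v f - v g"
  using tangent_linear[of v x f g 1 "-1"] by simp

text \<open>The Leibniz rule for 1 = 1 * 1 gives v(1) = 2 v(1).\<close>

lemma tangent_const:
  assumes "v \<in> T x"
  shows "v (\<lambda>y. c) = 0"
proof -
  have "v (\<lambda>y. 1) = 0"
    using tangent_mult[OF assms smooth_at_const smooth_at_const, of 1 1] by simp
  then show ?thesis
    using tangent_linear[OF assms smooth_at_const smooth_at_const, of c 1 0 1] by simp
qed

lemma tangent_scale: "v \<in> T x \<Longrightarrow> smooth_at x f \<Longrightarrow> v (\<lambda>y. c * f y) = c * v f"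
  using tangent_linear[of v x f f c 0] by simp

lemma tangent_sum:
  assumes "v \<in> T x" "\<And>i. i \<in> I \<Longrightarrow> smooth_at x (f i)"
  shows "v (\<lambda>y. \<Sum>i\<in>I. f i y) = (\<Sum>i\<in>I. v (f i))"
  using assms(2)
  by (induction I rule: infinite_finite_induct)
     (auto simp: tangent_const[OF assms(1)] tangent_add[OF assms(1)] smooth_at_sum)

text \<open>The characteristic function of a neighbourhood of \<open>x\<close> is smooth near \<open>x\<close>, so it serves as
  the cut-off function.\<close>

lemma tangent_cong:
  assumes v: "v \<in> T x" and W: "open W" "x \<in> W" and eq: "\<And>y. y \<in> W \<Longrightarrow> f y = g y"
  shows "v f = v g"
proof (cases "smooth_at x f")
  case True
  then have g: "smooth_at x g"
    using smooth_at_cong[OF W _ True] eq by blast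
  define \<eta> where "\<eta> = (\<lambda>y. if y \<in> W then 1 else 0 :: real)"
  have \<eta>: "smooth_at x \<eta>"
    by (rule smooth_at_cong[OF W _ smooth_at_const[of x 1]]) (simp add: \<eta>_def)
  have "(\<lambda>y. \<eta> y * (f y - g y)) = (\<lambda>y. 0)"
    using eq by (auto simp: \<eta>_def)
  then have "0 = v (\<lambda>y. \<eta> y * (f y - g y))"
    using tangent_const[OF v] by simp
  also have "\<dots> = \<eta> x * v (\<lambda>y. f y - g y) + (f x - g x) * v \<eta>"
    using tangent_mult[OF v \<eta> smooth_at_diff[OF True g]] .
  also have "\<dots> = v f - v g"
    using W(2) eq tangent_diff[OF v True g] by (simp add: \<eta>_def)
  finally show ?thesis by simp
next
  case False
  then have "\<not> smooth_at x g"
    using smooth_at_cong[OF W, of g f] eq by auto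
  then show ?thesis
    using False tangent_not_smooth[OF v] by simp
qed

text \<open>By Hadamard's lemma \<open>f\<close> is, near x, a constant plus products of a
  coordinate difference vanishing at x with a smooth function. The Leibniz rule at x then involves
  \<open>v\<close> only through its values on coordinates.\<close>

lemma tangent_eq_zeroI:
  assumes U: "(U, \<kappa>) \<in> \<A>" "x \<in> U" and v: "v \<in> T x"
    and zero: "\<And>b. b \<in> Basis \<Longrightarrow> v (\<lambda>y. \<kappa> y \<bullet> b) = 0"
  shows "v = (\<lambda>f. 0)"
proof
  fix f
  show "v f = 0"
  proof (cases "smooth_at x f")
    case True
    obtain r where r: "r > 0" "ball (\<kappa> x) r \<subseteq> \<kappa> ` U" "smooth_on (ball (\<kappa> x) r) (f \<circ> inv_into U \<kappa>)"
      using smooth_at_chartE[OF U True] .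
    obtain G where G: "\<And>b. smooth_on (ball (\<kappa> x) r) (G b)" and
      exp: "\<And>z. z \<in> ball (\<kappa> x) r \<Longrightarrow> (f \<circ> inv_into U \<kappa>) z =
        (f \<circ> inv_into U \<kappa>) (\<kappa> x) + (\<Sum>b\<in>Basis. ((z - \<kappa> x) \<bullet> b) * G b z)"
      using hadamard[OF r(3)] by metis
    let ?W = "U \<inter> \<kappa> -` ball (\<kappa> x) r"
    have W: "open ?W" "x \<in> ?W"
      using chart_open_preimage[OF U(1) open_ball] U r by auto
    have g: "smooth_at x (\<lambda>y. G b (\<kappa> y))" for b
    proof (rule smooth_at_chartI[OF U open_ball])
      show "smooth_on (ball (\<kappa> x) r) ((\<lambda>y. G b (\<kappa> y)) \<circ> inv_into U \<kappa>)"
        by (rule smooth_on_cong[OF open_ball _ G[of b]]) (use r U in auto)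
    qed (use r in auto)
    have \<kappa>: "smooth_at x (\<lambda>y. \<kappa> y \<bullet> b - \<kappa> x \<bullet> b)" for b
      by (rule smooth_at_diff[OF smooth_at_coordinate[OF U] smooth_at_const])
    have "f y = f x + (\<Sum>b\<in>Basis. (\<kappa> y \<bullet> b - \<kappa> x \<bullet> b) * G b (\<kappa> y))" if "y \<in> ?W" for y
      using exp[of "\<kappa> y"] that U by (simp add: inner_diff_left)
    then have "v f = v (\<lambda>y. f x + (\<Sum>b\<in>Basis. (\<kappa> y \<bullet> b - \<kappa> x \<bullet> b) * G b (\<kappa> y)))"
      by (rule tangent_cong[OF v W])
    also have "\<dots> = (\<Sum>b\<in>Basis. v (\<lambda>y. (\<kappa> y \<bullet> b - \<kappa> x \<bullet> b) * G b (\<kappa> y)))"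
      by (simp add: tangent_add[OF v] tangent_sum[OF v] tangent_const[OF v]
          smooth_at_sum smooth_at_mult smooth_at_const \<kappa> g)
    also have "\<dots> = 0"
      by (rule sum.neutral)
         (simp add: tangent_mult[OF v \<kappa> g] tangent_diff[OF v] smooth_at_coordinate[OF U]
           smooth_at_const tangent_const[OF v] zero)
    finally show ?thesis .
  next
    case False
    then show ?thesis
      using tangent_not_smooth[OF v] by blast
  qed
qed

lemma tangent_eqI:
  assumes U: "(U, \<kappa>) \<in> \<A>" "x \<in> U" and "u \<in> T x" "v \<in> T x"
    and "\<And>b. b \<in> Basis \<Longrightarrow> u (\<lambda>y. \<kappa> y \<bullet> b) = v (\<lambda>y. \<kappa> y \<bullet> b)"
  shows "u = v"
proof -
  have "(\<lambda>f. 1 * u f + (-1) * v f) = (\<lambda>f. 0)"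
    by (rule tangent_eq_zeroI[OF U tangent_combination]) (use assms in auto)
  then show ?thesis
    by (simp add: fun_eq_iff)
qed

text \<open>Partial differentiation in a chart. It supplies enough tangent vectors to show that the
  coordinate components of X are linearly independent.\<close>

lemma coordinate_derivation:
  assumes U: "(U, \<kappa>) \<in> \<A>" "x \<in> U"
  obtains v where "v \<in> T x" "\<And>c. v (\<lambda>y. \<kappa> y \<bullet> c) = b \<bullet> c"
proof -
  let ?v = "\<lambda>f. if smooth_at x f then frechet_derivative (f \<circ> inv_into U \<kappa>) (at (\<kappa> x)) b else 0"
  have D: "((f \<circ> inv_into U \<kappa>) has_derivative frechet_derivative (f \<circ> inv_into U \<kappa>) (at (\<kappa> x))) (at (\<kappa> x))"
    if sm: "smooth_at x f" for f
  proof -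
    obtain r where "r > 0" "smooth_on (ball (\<kappa> x) r) (f \<circ> inv_into U \<kappa>)"
      using smooth_at_chartE[OF U sm] by blast
    then show ?thesis
      using smooth_on_has_derivative centre_in_ball by blast
  qed
  have Deq: "frechet_derivative (f \<circ> inv_into U \<kappa>) (at (\<kappa> x)) = D'"
    if "((f \<circ> inv_into U \<kappa>) has_derivative D') (at (\<kappa> x))" for f D'
    using frechet_derivative_at[OF that] by simp
  have "?v \<in> T x"
    unfolding tangent_space_def mem_Collect_eq
  proof (intro conjI allI impI)
    fix f g :: "'a \<Rightarrow> real" and a b' assume sm: "smooth_at x f" "smooth_at x g"
    have "(((\<lambda>y. a * f y + b' * g y) \<circ> inv_into U \<kappa>) has_derivative
      (\<lambda>h. a * frechet_derivative (f \<circ> inv_into U \<kappa>) (at (\<kappa> x)) h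
         + b' * frechet_derivative (g \<circ> inv_into U \<kappa>) (at (\<kappa> x)) h)) (at (\<kappa> x))"
      using D[OF sm(1)] D[OF sm(2)] unfolding o_def by (intro derivative_intros)
    from Deq[OF this] show "?v (\<lambda>y. a * f y + b' * g y) = a * ?v f + b' * ?v g"
      using sm smooth_at_combination[OF sm] by simp
    have "(((\<lambda>y. f y * g y) \<circ> inv_into U \<kappa>) has_derivative
      (\<lambda>h. f x * frechet_derivative (g \<circ> inv_into U \<kappa>) (at (\<kappa> x)) h
         + frechet_derivative (f \<circ> inv_into U \<kappa>) (at (\<kappa> x)) h * g x)) (at (\<kappa> x))"
      using has_derivative_mult[OF D[OF sm(1)] D[OF sm(2)]] U by (simp add: o_def)
    from Deq[OF this] show "?v (\<lambda>y. f y * g y) = f x * ?v g + g x * ?v f"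
      using sm smooth_at_mult[OF sm] by simp
  qed simp
  moreover have "?v (\<lambda>y. \<kappa> y \<bullet> c) = b \<bullet> c" for c
  proof -
    have "((\<lambda>z. z \<bullet> c) has_derivative (\<lambda>h. h \<bullet> c)) (at (\<kappa> x))"
      by (auto intro!: derivative_eq_intros)
    then have "(((\<lambda>y. \<kappa> y \<bullet> c) \<circ> inv_into U \<kappa>) has_derivative (\<lambda>h. h \<bullet> c)) (at (\<kappa> x))"
      by (rule has_derivative_transform_within_open[OF _ chart_image_open[OF U(1)]])
         (use U in auto)
    from Deq[OF this] show ?thesis
      using smooth_at_coordinate[OF U] by simp
  qed
  ultimately show thesis
    using that by blast
qed


subsection \<open>Vector fields\<close>

abbreviation svf :: "'a vfield \<Rightarrow> bool"
  where "svf \<equiv> smooth_vfield \<A>"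

lemma svf_tangent: "svf V \<Longrightarrow> V x \<in> T x"
  unfolding smooth_vfield_def by blast

lemma svf_smooth: "svf V \<Longrightarrow> smooth_at x f \<Longrightarrow> smooth_at x (\<lambda>y. V y f)"
  unfolding smooth_vfield_def by blast

lemma svf_combination:
  assumes "svf U" "svf V"
  shows "svf (\<lambda>x f. a * U x f + b * V x f)"
  unfolding smooth_vfield_def
  using assms by (auto intro: tangent_combination svf_tangent smooth_at_combination svf_smooth)

text \<open>In U(V(fg)) - V(U(fg)) the products of first derivatives are symmetric in U and V and
  cancel. As f and g are smooth only near x, the inner identities hold only there and pass through
  the outer derivation by \<open>tangent_cong\<close>.\<close>

lemma svf_bracket:
  assumes U: "svf U" and V: "svf V"
  shows "svf (bracket \<A> U V)"
  unfolding smooth_vfield_def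
proof (intro conjI allI impI)
  fix x f assume sm: "smooth_at x f"
  obtain W where W: "open W" "x \<in> W" "\<forall>y\<in>W. smooth_at y f"
    using smooth_at_open[OF sm] by blast
  show "smooth_at x (\<lambda>y. bracket \<A> U V y f)"
  proof (rule smooth_at_cong[OF W(1,2)])
    show "smooth_at x (\<lambda>y. U y (\<lambda>z. V z f) - V y (\<lambda>z. U z f))"
      by (rule smooth_at_diff[OF svf_smooth[OF U svf_smooth[OF V sm]] svf_smooth[OF V svf_smooth[OF U sm]]])
  qed (simp add: bracket_def W(3))
next
  fix x
  show "bracket \<A> U V x \<in> T x"
    unfolding tangent_space_def mem_Collect_eq
  proof (intro conjI allI impI)
    fix f :: "'a \<Rightarrow> real" assume "\<not> smooth_at x f"
    then show "bracket \<A> U V x f = 0"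
      by (simp add: bracket_def)
  next
    fix f g :: "'a \<Rightarrow> real" and a b assume sm: "smooth_at x f" "smooth_at x g"
    obtain W where W: "open W" "x \<in> W" "\<forall>y\<in>W. smooth_at y f"
      using smooth_at_open[OF sm(1)] by blast
    obtain W' where W': "open W'" "x \<in> W'" "\<forall>y\<in>W'. smooth_at y g"
      using smooth_at_open[OF sm(2)] by blast
    have Wo: "open (W \<inter> W')" "x \<in> W \<inter> W'"
      using W W' by auto
    have lin: "Z x (\<lambda>y. Z' y (\<lambda>z. a * f z + b * g z)) = a * Z x (\<lambda>y. Z' y f) + b * Z x (\<lambda>y. Z' y g)"
      if "svf Z" "svf Z'" for Z Z'
    proof -
      have "Z x (\<lambda>y. Z' y (\<lambda>z. a * f z + b * g z)) = Z x (\<lambda>y. a * Z' y f + b * Z' y g)"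
        by (rule tangent_cong[OF svf_tangent[OF that(1)] Wo])
           (simp add: tangent_linear[OF svf_tangent[OF that(2)]] W(3) W'(3))
      then show ?thesis
        by (simp add: tangent_linear[OF svf_tangent[OF that(1)]] svf_smooth that sm)
    qed
    show "bracket \<A> U V x (\<lambda>y. a * f y + b * g y) = a * bracket \<A> U V x f + b * bracket \<A> U V x g"
      using lin[OF U V] lin[OF V U] sm smooth_at_combination[OF sm]
      by (simp add: bracket_def algebra_simps)
    have mult: "Z x (\<lambda>y. Z' y (\<lambda>z. f z * g z)) =
        f x * Z x (\<lambda>y. Z' y g) + Z' x g * Z x f + (g x * Z x (\<lambda>y. Z' y f) + Z' x f * Z x g)"
      if "svf Z" "svf Z'" for Z Z'
    proof -
      have "Z x (\<lambda>y. Z' y (\<lambda>z. f z * g z)) = Z x (\<lambda>y. f y * Z' y g + g y * Z' y f)"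
        by (rule tangent_cong[OF svf_tangent[OF that(1)] Wo])
           (simp add: tangent_mult[OF svf_tangent[OF that(2)]] W(3) W'(3))
      then show ?thesis
        by (simp add: tangent_add[OF svf_tangent[OF that(1)]] tangent_mult[OF svf_tangent[OF that(1)]]
            smooth_at_mult svf_smooth that sm)
    qed
    show "bracket \<A> U V x (\<lambda>y. f y * g y) = f x * bracket \<A> U V x g + g x * bracket \<A> U V x f"
      using mult[OF U V] mult[OF V U] sm smooth_at_mult[OF sm]
      by (simp add: bracket_def algebra_simps)
  qed
qed

end


section \<open>The adjoint of \<open>X\<close>\<close>

text \<open>Gram-Schmidt, one vector at a time: the linear system is solved by rational operations only, so
  the solution inherits smoothness.\<close>

lemma (in smooth_manifold) smooth_gram_solution:
  fixes r :: "'b \<Rightarrow> 'a \<Rightarrow> real^'m" and c :: "'b \<Rightarrow> 'a \<Rightarrow> real"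
  assumes "finite B" and x: "x \<in> W"
    and "\<And>b j. b \<in> B \<Longrightarrow> smooth_at x (\<lambda>y. r b y $ j)"
    and "\<And>y l. y \<in> W \<Longrightarrow> (\<Sum>b\<in>B. l b *\<^sub>R r b y) = 0 \<Longrightarrow> \<forall>b\<in>B. l b = 0"
    and "\<And>b. b \<in> B \<Longrightarrow> smooth_at x (c b)"
  shows "\<exists>w. (\<forall>j. smooth_at x (\<lambda>y. w y $ j)) \<and>
    (\<forall>y\<in>W. (\<exists>l. w y = (\<Sum>b\<in>B. l b *\<^sub>R r b y)) \<and> (\<forall>b\<in>B. w y \<bullet> r b y = c b y))"
  using assms(1,3-)
proof (induction B arbitrary: c rule: finite_induct)
  case empty
  show ?case
    by (rule exI[of _ "\<lambda>y. 0"]) (auto intro: smooth_at_const)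
next
  case (insert b B)
  have ind: "\<forall>b'\<in>B. l b' = 0" if "y \<in> W" "(\<Sum>b\<in>B. l b *\<^sub>R r b y) = 0" for y l
  proof -
    have "(\<Sum>b'\<in>B. (l(b := 0)) b' *\<^sub>R r b' y) = (\<Sum>b'\<in>B. l b' *\<^sub>R r b' y)"
      using insert.hyps by (intro sum.cong) auto
    then have "\<forall>b'\<in>B. (l(b := 0)) b' = 0"
      using insert.prems(2)[of y "l(b := 0)"] that insert.hyps by simp
    then show ?thesis
      using insert.hyps by (metis fun_upd_other)
  qed
  have inner: "u \<bullet> v = (\<Sum>i\<in>UNIV. u $ i * v $ i)" for u v :: "real^'m"
    by (simp add: inner_vec_def)
  have rs: "smooth_at x (\<lambda>y. r b' y $ j)" if "b' \<in> insert b B" for b' j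
    using insert.prems(1) that by blast
  have IH: "\<exists>w. (\<forall>j. smooth_at x (\<lambda>y. w y $ j)) \<and>
      (\<forall>y\<in>W. (\<exists>l. w y = (\<Sum>b\<in>B. l b *\<^sub>R r b y)) \<and> (\<forall>b\<in>B. w y \<bullet> r b y = c b y))"
    if "\<And>b. b \<in> B \<Longrightarrow> smooth_at x (c b)" for c
    by (rule insert.IH) (use rs ind that in auto)
  have "smooth_at x (\<lambda>y. r b y \<bullet> r b' y)" if "b' \<in> B" for b'
    unfolding inner using that by (auto intro!: smooth_at_sum smooth_at_mult rs)
  \<comment> \<open>\<open>p\<close> is the orthogonal projection of the new vector to the span of
    the old ones, found by the induction hypothesis with right-hand sides
    \<open>r b y \<bullet> r b' y\<close>.\<close>
  then obtain p where p: "\<And>j. smooth_at x (\<lambda>y. p y $ j)"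
    "\<forall>y\<in>W. (\<exists>l. p y = (\<Sum>b\<in>B. l b *\<^sub>R r b y)) \<and> (\<forall>b'\<in>B. p y \<bullet> r b' y = r b y \<bullet> r b' y)"
    using IH[of "\<lambda>b' y. r b y \<bullet> r b' y"] by auto
  obtain w where w: "\<And>j. smooth_at x (\<lambda>y. w y $ j)"
    "\<forall>y\<in>W. (\<exists>l. w y = (\<Sum>b\<in>B. l b *\<^sub>R r b y)) \<and> (\<forall>b'\<in>B. w y \<bullet> r b' y = c b' y)"
    using IH[of c] insert.prems(3) by auto
  \<comment> \<open>\<open>s\<close> is the part of the new vector orthogonal to the old ones, so
    adding a multiple of it keeps the old equations; \<open>k\<close> is the multiple that satisfies
    the new one, since the inner products of \<open>s\<close> with \<open>r b\<close> and with
    itself agree.\<close>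
  define s where "s = (\<lambda>y. r b y - p y)"
  define k where "k = (\<lambda>y. (c b y - w y \<bullet> r b y) * inverse (s y \<bullet> s y))"
  have orth: "s y \<bullet> r b' y = 0" if "y \<in> W" "b' \<in> B" for y b'
    using p(2) that by (simp add: s_def inner_diff_left)
  have nz: "s y \<noteq> 0" if y: "y \<in> W" for y
  proof
    assume "s y = 0"
    obtain l where l: "p y = (\<Sum>b\<in>B. l b *\<^sub>R r b y)"
      using p(2) y by blast
    have "(\<Sum>b'\<in>B. (l(b := -1)) b' *\<^sub>R r b' y) = p y"
      unfolding l using insert.hyps by (intro sum.cong) auto
    then have "(\<Sum>b'\<in>insert b B. (l(b := -1)) b' *\<^sub>R r b' y) = 0"
      using insert.hyps \<open>s y = 0\<close> by (simp add: s_def)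
    then show False
      using insert.prems(2)[OF y, of "l(b := -1)"] by simp
  qed
  have sr: "s y \<bullet> r b y = s y \<bullet> s y" if y: "y \<in> W" for y
  proof -
    obtain l where l: "p y = (\<Sum>b\<in>B. l b *\<^sub>R r b y)"
      using p(2) y by blast
    have "s y \<bullet> p y = 0"
      unfolding l inner_sum_right using orth[OF y] by simp
    then have "s y \<bullet> (s y + p y) = s y \<bullet> s y"
      by (simp add: inner_add_right)
    then show ?thesis
      by (simp add: s_def)
  qed
  have ss: "smooth_at x (\<lambda>y. s y $ j)" for j
    unfolding s_def vector_minus_component using smooth_at_diff[OF rs p(1)] by blast
  have "smooth_at x (\<lambda>y. w y \<bullet> r b y)"
    unfolding inner by (auto intro!: smooth_at_sum smooth_at_mult rs w)
  moreover have "smooth_at x (\<lambda>y. inverse (s y \<bullet> s y))"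
  proof (rule smooth_at_inverse)
    show "smooth_at x (\<lambda>y. s y \<bullet> s y)"
      unfolding inner by (auto intro!: smooth_at_sum smooth_at_mult ss)
  qed (use nz[OF x] in simp)
  ultimately have ks: "smooth_at x k"
    unfolding k_def using insert.prems(3) by (auto intro!: smooth_at_mult smooth_at_diff)
  show ?case
  proof (intro exI[of _ "\<lambda>y. w y + k y *\<^sub>R s y"] conjI allI ballI)
    fix j
    show "smooth_at x (\<lambda>y. (w y + k y *\<^sub>R s y) $ j)"
      using smooth_at_add[OF w(1) smooth_at_mult[OF ks ss]] by simp
  next
    fix y assume y: "y \<in> W"
    obtain l l' where l: "p y = (\<Sum>b\<in>B. l b *\<^sub>R r b y)" "w y = (\<Sum>b\<in>B. l' b *\<^sub>R r b y)"
      using p(2) w(2) y by meson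
    let ?l = "\<lambda>b'. if b' = b then k y else l' b' - k y * l b'"
    have "(\<Sum>b'\<in>B. ?l b' *\<^sub>R r b' y) = (\<Sum>b'\<in>B. l' b' *\<^sub>R r b' y - k y *\<^sub>R (l b' *\<^sub>R r b' y))"
      using insert.hyps by (intro sum.cong) (auto simp: scaleR_diff_left)
    also have "\<dots> = w y - k y *\<^sub>R p y"
      unfolding l by (simp add: sum_subtractf scaleR_sum_right)
    finally show "\<exists>l. w y + k y *\<^sub>R s y = (\<Sum>b'\<in>insert b B. l b' *\<^sub>R r b' y)"
      using insert.hyps by (intro exI[of _ ?l]) (simp add: s_def scaleR_diff_right)
    fix b' assume b': "b' \<in> insert b B"
    show "(w y + k y *\<^sub>R s y) \<bullet> r b' y = c b' y"
    proof (cases "b' = b")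
      case True
      have "(w y + k y *\<^sub>R s y) \<bullet> r b y = w y \<bullet> r b y + k y * (s y \<bullet> s y)"
        by (simp add: inner_add_left sr[OF y])
      also have "\<dots> = c b y"
        using nz[OF y] by (simp add: k_def field_simps)
      finally show ?thesis using True by simp
    next
      case False
      then show ?thesis
        using b' w(2) y orth by (simp add: inner_add_left)
    qed
  qed
qed

locale LW_structure = smooth_manifold \<A>
  for \<A> :: "('a::topological_space, 'e::euclidean_space) chart set" +
  fixes X :: "'a \<Rightarrow> real^'m \<Rightarrow> 'a tangent"
  assumes X_linear: "linear (\<lambda>w. X x w f)"
    and X_onto: "range (X x) = tangent_space \<A> x"
    and X_smooth: "smooth_vfield \<A> (\<lambda>x. X x w)"
begin

abbreviation Y :: "'a \<Rightarrow> 'a tangent \<Rightarrow> real^'m"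
  where "Y \<equiv> adjoint_map X"

definition ker :: "'a \<Rightarrow> (real^'m) set"
  where "ker x = {w. X x w = (\<lambda>f. 0)}"

lemma X_tangent: "X x w \<in> T x"
  using X_onto by blast

lemma X_combination: "X x (a *\<^sub>R v + b *\<^sub>R w) = (\<lambda>f. a * X x v f + b * X x w f)"
  by (simp add: fun_eq_iff linear_add[OF X_linear] linear_scale[OF X_linear])

lemma X_add: "X x (v + w) = (\<lambda>f. X x v f + X x w f)"
  using X_combination[of x 1 v 1 w] by simp

lemma X_diff: "X x (v - w) = (\<lambda>f. X x v f - X x w f)"
  using X_combination[of x 1 v "-1" w] by simp

lemma X_axis_sum: "X x w f = (\<Sum>j\<in>UNIV. w $ j * X x (axis j 1) f)"
proof -
  have "X x w f = X x (\<Sum>j\<in>UNIV. w $ j *\<^sub>R axis j 1) f"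
    using basis_expansion[of w] by (simp add: scalar_mult_eq_scaleR)
  then show ?thesis
    by (simp add: linear_sum[OF X_linear] linear_scale[OF X_linear])
qed

lemma subspace_ker: "subspace (ker x)"
  unfolding subspace_def ker_def
  using X_combination[of x 0 0 0 0] X_combination[of x _ _ 0 0] by (auto simp: X_add)

lemma ker_decomposition:
  obtains n z where "n \<in> (ker x)\<^sup>\<bottom>" "z \<in> ker x" "k = n + z"
proof -
  obtain z n where "z \<in> span (ker x)" "\<And>w. w \<in> span (ker x) \<Longrightarrow> orthogonal n w" "k = z + n"
    using orthogonal_subspace_decomp_exists[of "ker x" k] by blast
  moreover have "span (ker x) = ker x"
    using subspace_ker span_eq_iff by blast
  ultimately show thesis
    using that[of n z] by (auto simp: orthogonal_comp_def orthogonal_commute add.commute)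
qed

lemma ker_perp_inner: "n \<in> (ker x)\<^sup>\<bottom> \<Longrightarrow> z \<in> ker x \<Longrightarrow> n \<bullet> z = 0"
  by (auto simp: orthogonal_comp_def orthogonal_def inner_commute)

lemma inj_on_ker_perp: "inj_on (X x) ((ker x)\<^sup>\<bottom>)"
proof (rule inj_onI)
  fix u v assume uv: "u \<in> (ker x)\<^sup>\<bottom>" "v \<in> (ker x)\<^sup>\<bottom>" "X x u = X x v"
  then have "u - v \<in> ker x"
    by (simp add: ker_def X_diff)
  then have "(u - v) \<bullet> (u - v) = 0"
    using uv(1,2) ker_perp_inner[of u x "u - v"] ker_perp_inner[of v x "u - v"] by (simp add: inner_diff_left)
  then show "u = v" by simp
qed

text \<open>For w orthogonal to the kernel the induced inner product of X w and X k is that of w and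
  k, the kernel part of k contributing nothing to either. Thus Y(x) inverts X(x) on the orthogonal
  complement of the kernel, the description used from here on.\<close>

lemma adjoint_map_eq:
  assumes "w \<in> (ker x)\<^sup>\<bottom>"
  shows "Y x (X x w) = w"
proof -
  let ?N = "(ker x)\<^sup>\<bottom>"
  have inv: "inv_into ?N (X x) (X x n) = n" if "n \<in> ?N" for n
    using inv_into_f_f[OF inj_on_ker_perp that] .
  have metric: "induced_metric X x (X x w) (X x k) = w \<bullet> k" for k
  proof -
    obtain n z where nz: "n \<in> ?N" "z \<in> ker x" "k = n + z"
      using ker_decomposition by blast
    then have "X x k = X x n"
      by (simp add: X_add ker_def)
    then have "induced_metric X x (X x w) (X x k) = w \<bullet> n"
      using inv[OF assms] inv[OF nz(1)] by (simp add: induced_metric_def Let_def ker_def)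
    then show ?thesis
      using ker_perp_inner[OF assms nz(2)] nz(3) by (simp add: inner_add_right)
  qed
  show ?thesis
    unfolding adjoint_map_def metric
    by (rule the_equality) (auto simp: vector_eq_rdot)
qed

lemma adjoint_map_ker_perp: "v \<in> T x \<Longrightarrow> Y x v \<in> (ker x)\<^sup>\<bottom>"
  and X_adjoint_map [simp]: "v \<in> T x \<Longrightarrow> X x (Y x v) = v"
proof -
  assume "v \<in> T x"
  then obtain k where k: "v = X x k"
    using X_onto by (metis image_iff)
  obtain n z where nz: "n \<in> (ker x)\<^sup>\<bottom>" "z \<in> ker x" "k = n + z"
    using ker_decomposition by blast
  then have "v = X x n"
    by (simp add: k X_add ker_def)
  then show "Y x v \<in> (ker x)\<^sup>\<bottom>" "X x (Y x v) = v"
    using adjoint_map_eq[OF nz(1)] nz(1) by auto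
qed

lemma adjoint_map_zero: "Y x (\<lambda>f. 0) = 0"
proof -
  have "0 \<in> (ker x)\<^sup>\<bottom>" "X x 0 = (\<lambda>f. 0)"
    using X_combination[of x 0 0 0 0] by (auto simp: orthogonal_comp_def orthogonal_def)
  then show ?thesis
    using adjoint_map_eq by metis
qed

text \<open>In a chart, X(y)w = V(y) is one equation
  \<open>w \<bullet> r b y = V y (\<lambda>z. \<kappa> z \<bullet> b)\<close> for each b. Among its
  solutions Y V is the one orthogonal to the kernel, and a solution in the span of the rows
  \<open>r b y\<close> has this property; hence the span clause in the Gram-Schmidt lemma.\<close>

lemma smooth_adjoint_map:
  assumes V: "smooth_vfield \<A> V"
  shows "smooth_at x (\<lambda>y. Y y (V y) $ j)"
proof -
  obtain U \<kappa> where U: "(U, \<kappa>) \<in> \<A>" "x \<in> U"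
    using chart_cover by blast
  define r where "r = (\<lambda>b y. \<chi> i. X y (axis i 1) (\<lambda>z. \<kappa> z \<bullet> b))"
  have r: "w \<bullet> r b y = X y w (\<lambda>z. \<kappa> z \<bullet> b)" for w b y
    unfolding X_axis_sum[of y w] by (simp add: r_def inner_vec_def)
  have "smooth_at x (\<lambda>y. r b y $ i)" for b i
    using svf_smooth[OF X_smooth smooth_at_coordinate[OF U]] by (simp add: r_def)
  moreover have "\<forall>b\<in>Basis. l b = 0" if y: "y \<in> U" and l: "(\<Sum>b\<in>Basis. l b *\<^sub>R r b y) = 0" for y and l :: "'e \<Rightarrow> real"
  proof
    fix b :: 'e assume b: "b \<in> Basis"
    \<comment> \<open>The lift by Y of the coordinate derivation in direction b, paired with the
      relation, isolates the coefficient \<open>l b\<close>.\<close>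
    obtain v where v: "v \<in> T y" "\<And>c. v (\<lambda>z. \<kappa> z \<bullet> c) = b \<bullet> c"
      using coordinate_derivation[OF U(1) y, of b] by blast
    have "0 = Y y v \<bullet> (\<Sum>b\<in>Basis. l b *\<^sub>R r b y)"
      using l by simp
    also have "\<dots> = (\<Sum>c\<in>Basis. l c * (b \<bullet> c))"
      using v by (simp add: inner_sum_right r)
    also have "\<dots> = l b"
      using b by (simp add: inner_Basis if_distrib sum.delta cong: if_cong)
    finally show "l b = 0" by simp
  qed
  moreover have "smooth_at x (\<lambda>y. V y (\<lambda>z. \<kappa> z \<bullet> b))" for b
    using svf_smooth[OF V smooth_at_coordinate[OF U]] .
  ultimately obtain w where w: "\<And>j. smooth_at x (\<lambda>y. w y $ j)"
    "\<forall>y\<in>U. (\<exists>l. w y = (\<Sum>b\<in>Basis. l b *\<^sub>R r b y)) \<and> (\<forall>b\<in>Basis. w y \<bullet> r b y = V y (\<lambda>z. \<kappa> z \<bullet> b))"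
    using smooth_gram_solution[OF finite_Basis U(2), of r "\<lambda>b y. V y (\<lambda>z. \<kappa> z \<bullet> b)"] by blast
  have "w y = Y y (V y)" if y: "y \<in> U" for y
  proof -
    obtain l where l: "w y = (\<Sum>b\<in>Basis. l b *\<^sub>R r b y)"
      using w(2) y by blast
    have "X y (w y) = V y"
      by (rule tangent_eqI[OF U(1) y X_tangent svf_tangent[OF V]]) (use w(2) y r in auto)
    moreover have "w y \<in> (ker y)\<^sup>\<bottom>"
      by (auto simp: orthogonal_comp_def orthogonal_def l inner_sum_right r ker_def)
    ultimately show ?thesis
      using adjoint_map_eq by metis
  qed
  then show ?thesis
    by (intro smooth_at_cong[OF chart_open[OF U(1)] U(2) _ w(1)]) simp
qed


section \<open>Differential forms\<close>

abbreviation svfs :: "'a vfield list \<Rightarrow> bool"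
  where "svfs Vs \<equiv> \<forall>V\<in>set Vs. svf V"

abbreviation ev :: "'a vfield list \<Rightarrow> 'a \<Rightarrow> 'a tangent list"
  where "ev Vs x \<equiv> map (\<lambda>V. V x) Vs"

abbreviation sform :: "nat \<Rightarrow> 'a form \<Rightarrow> bool"
  where "sform \<equiv> smooth_form \<A>"

abbreviation ii :: "'a vfield \<Rightarrow> 'a form \<Rightarrow> 'a form"
  where "ii \<equiv> interior_product"

text \<open>Freezing the vector \<open>Y x v\<close> of the Euclidean space gives a field that is
  smooth on the whole manifold and passes through \<open>v\<close> at \<open>x\<close>.\<close>

definition extend :: "'a \<Rightarrow> 'a tangent \<Rightarrow> 'a vfield"
  where "extend x v = (\<lambda>y. X y (Y x v))"

lemma svf_extend: "svf (extend x v)"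
  unfolding extend_def by (rule X_smooth)

lemma extend_at [simp]: "v \<in> T x \<Longrightarrow> extend x v x = v"
  by (simp add: extend_def)

lemma extend_list:
  assumes "set vs \<subseteq> T x"
  obtains Vs where "svfs Vs" "ev Vs x = vs"
proof
  show "svfs (map (extend x) vs)"
    by (auto simp: svf_extend)
  show "ev (map (extend x) vs) x = vs"
    using assms by (auto intro!: map_idI)
qed

lemma ev_tangent: "svfs Vs \<Longrightarrow> set (ev Vs x) \<subseteq> T x"
  using svf_tangent by auto

lemma tangent_sum_combination:
  assumes "finite J" "\<And>j. j \<in> J \<Longrightarrow> u j \<in> T x"
  shows "(\<lambda>f. \<Sum>j\<in>J. a j * u j f) \<in> T x"
  using assms
proof (induction J rule: finite_induct)
  case (insert j J)
  then show ?case
    using tangent_combination[of "u j" x "\<lambda>f. \<Sum>j\<in>J. a j * u j f" "a j" 1] by simp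
qed (simp add: tangent_zero)

section \<open>Contraction, alternation and degree recursion for forms\<close>

lemma interior_apply: "ii A \<phi> x vs = \<phi> x (A x # vs)"
  by (simp add: interior_product_def)

lemma form_junk: "sform q \<phi> \<Longrightarrow> \<not> (length vs = q \<and> set vs \<subseteq> T x) \<Longrightarrow> \<phi> x vs = 0"
  unfolding smooth_form_def by blast

lemma form_multilinear:
  "sform q \<phi> \<Longrightarrow> length vs = q \<Longrightarrow> set vs \<subseteq> T x \<Longrightarrow> i < q \<Longrightarrow> u \<in> T x \<Longrightarrow> w \<in> T x \<Longrightarrow>
    \<phi> x (vs[i := (\<lambda>f. a * u f + b * w f)]) = a * \<phi> x (vs[i := u]) + b * \<phi> x (vs[i := w])"
  unfolding smooth_form_def by blast

lemma form_alternating: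
  "sform q \<phi> \<Longrightarrow> length vs = q \<Longrightarrow> set vs \<subseteq> T x \<Longrightarrow> i < j \<Longrightarrow> j < q \<Longrightarrow> vs ! i = vs ! j \<Longrightarrow> \<phi> x vs = 0"
  unfolding smooth_form_def by blast

lemma form_smooth:
  assumes "sform q \<phi>" "svfs Vs"
  shows "smooth_at x (\<lambda>y. \<phi> y (ev Vs y))"
proof (cases "length Vs = q")
  case True
  then have "smooth_fun_on \<A> UNIV (\<lambda>y. \<phi> y (ev Vs y))"
    using assms unfolding smooth_form_def by blast
  then show ?thesis
    using smooth_fun_on_UNIV_iff by blast
next
  case False
  then show ?thesis
    using form_junk[OF assms(1)] by (simp add: smooth_at_const)
qed

lemma form_head_linear:
  assumes \<phi>: "sform q \<phi>" and uw: "u \<in> T x" "w \<in> T x"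
  shows "\<phi> x ((\<lambda>f. a * u f + b * w f) # vs) = a * \<phi> x (u # vs) + b * \<phi> x (w # vs)"
proof (cases "length (u # vs) = q \<and> set vs \<subseteq> T x")
  case True
  then show ?thesis
    using form_multilinear[OF \<phi>, of "u # vs" x 0 u w a b] uw by auto
next
  case False
  then have "\<phi> x (v # vs) = 0" for v
    using form_junk[OF \<phi>, of "v # vs" x] by auto
  then show ?thesis by simp
qed

lemma form_head_sum:
  assumes \<phi>: "sform q \<phi>" and "finite J" "\<And>j. j \<in> J \<Longrightarrow> u j \<in> T x"
  shows "\<phi> x ((\<lambda>f. \<Sum>j\<in>J. a j * u j f) # vs) = (\<Sum>j\<in>J. a j * \<phi> x (u j # vs))"
  using assms(2,3)
proof (induction J rule: finite_induct)
  case empty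
  show ?case
    using form_head_linear[OF \<phi> tangent_zero tangent_zero, of x 0 0 vs] by simp
next
  case (insert j J)
  then show ?case
    using form_head_linear[OF \<phi> _ tangent_sum_combination[OF insert.hyps(1)], of "u j" x u "a j" 1 a vs]
    by simp
qed

lemma form_head_zero: "sform q \<phi> \<Longrightarrow> \<phi> x ((\<lambda>f. 0) # vs) = 0"
  using form_head_linear[OF _ tangent_zero tangent_zero, of q \<phi> x 0 0 vs] by simp

lemma form_head_twice:
  assumes \<phi>: "sform q \<phi>"
  shows "\<phi> x (v # v # vs) = 0"
proof (cases "length (v # v # vs) = q \<and> set (v # v # vs) \<subseteq> T x")
  case True
  then show ?thesis
    using form_alternating[OF \<phi>, of "v # v # vs" x 0 1] by auto
next
  case False
  then show ?thesis
    using form_junk[OF \<phi>] by blast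
qed

lemma form_interior_Suc:
  assumes \<phi>: "sform (Suc q) \<phi>" and A: "svf A"
  shows "sform q (ii A \<phi>)"
  unfolding smooth_form_def interior_apply
proof (intro conjI allI impI)
  fix x vs
  assume "\<not> (length vs = q \<and> set vs \<subseteq> T x)"
  then show "\<phi> x (A x # vs) = 0"
    by (intro form_junk[OF \<phi>]) auto
next
  fix x vs i u w and a b :: real
  assume "length vs = q" "set vs \<subseteq> T x" "i < q" "u \<in> T x" "w \<in> T x"
  then show "\<phi> x (A x # vs[i := (\<lambda>f. a * u f + b * w f)])
      = a * \<phi> x (A x # vs[i := u]) + b * \<phi> x (A x # vs[i := w])"
    using form_multilinear[OF \<phi>, of "A x # vs" x "Suc i" u w a b] svf_tangent[OF A] by simp
next
  fix x vs i j
  assume "length vs = q" "set vs \<subseteq> T x" "i < j" "j < q" "vs ! i = vs ! j"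
  then show "\<phi> x (A x # vs) = 0"
    using form_alternating[OF \<phi>, of "A x # vs" x "Suc i" "Suc j"] svf_tangent[OF A] by simp
next
  fix Vs assume "length Vs = q" "svfs Vs"
  then show "smooth_fun_on \<A> UNIV (\<lambda>x. \<phi> x (A x # ev Vs x))"
    using form_smooth[OF \<phi>, of "A # Vs"] A unfolding smooth_fun_on_UNIV_iff by simp
qed

lemma form_zero: "sform q (\<lambda>x vs. 0)"
  unfolding smooth_form_def smooth_fun_on_UNIV_iff by (simp add: smooth_at_const)

lemma form_interior_0: "sform 0 \<phi> \<Longrightarrow> ii A \<phi> = (\<lambda>x vs. 0)"
  using form_junk[of 0 \<phi>] by (simp add: fun_eq_iff interior_apply)

text \<open>Truncated subtraction is right at q = 0: the contraction of a 0-form is the zero form,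
  which has every degree.\<close>

lemma form_interior: "sform q \<phi> \<Longrightarrow> svf A \<Longrightarrow> sform (q - 1) (ii A \<phi>)"
  using form_interior_Suc form_interior_0 form_zero by (cases q) auto

lemma form_combination:
  assumes \<phi>: "sform q \<phi>" and \<psi>: "sform q \<psi>"
  shows "sform q (\<lambda>x vs. a * \<phi> x vs + b * \<psi> x vs)"
  unfolding smooth_form_def
proof (intro conjI allI impI)
  fix Vs assume "length Vs = q" "svfs Vs"
  then show "smooth_fun_on \<A> UNIV (\<lambda>x. a * \<phi> x (ev Vs x) + b * \<psi> x (ev Vs x))"
    using form_smooth \<phi> \<psi> unfolding smooth_fun_on_UNIV_iff by (auto intro: smooth_at_combination)
next
  fix x vs i j
  assume "length vs = q" "set vs \<subseteq> T x" "i < j" "j < q" "vs ! i = vs ! j"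
  then show "a * \<phi> x vs + b * \<psi> x vs = 0"
    using form_alternating[OF \<phi>] form_alternating[OF \<psi>] by simp
qed (simp_all add: form_junk[OF \<phi>] form_junk[OF \<psi>] form_multilinear[OF \<phi>] form_multilinear[OF \<psi>] algebra_simps)

lemma form_diff: "sform q \<phi> \<Longrightarrow> sform q \<psi> \<Longrightarrow> sform q (\<lambda>x vs. \<phi> x vs - \<psi> x vs)"
  using form_combination[of q \<phi> \<psi> 1 "-1"] by simp

text \<open>Polarization of the vanishing on equal arguments at u + v. It is stated for a bare
  function \<open>g\<close> so as to serve also for expressions not yet known to be forms.\<close>

lemma alternating_swap:
  fixes g :: "'a tangent list \<Rightarrow> real"
  assumes uv: "u \<in> T x" "v \<in> T x"
    and l1: "\<And>u w vs. u \<in> T x \<Longrightarrow> w \<in> T x \<Longrightarrow> g ((\<lambda>f. u f + w f) # vs) = g (u # vs) + g (w # vs)"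
    and l2: "\<And>z u w vs. z \<in> T x \<Longrightarrow> u \<in> T x \<Longrightarrow> w \<in> T x \<Longrightarrow>
      g (z # (\<lambda>f. u f + w f) # vs) = g (z # u # vs) + g (z # w # vs)"
    and alt: "\<And>v. v \<in> T x \<Longrightarrow> g (v # v # vs) = 0"
  shows "g (u # v # vs) = - g (v # u # vs)"
proof -
  have s: "(\<lambda>f. u f + v f) \<in> T x"
    using tangent_combination[OF uv, of 1 1] by simp
  have "0 = g ((\<lambda>f. u f + v f) # (\<lambda>f. u f + v f) # vs)"
    using alt[OF s] by simp
  also have "\<dots> = g (u # u # vs) + g (u # v # vs) + (g (v # u # vs) + g (v # v # vs))"
    by (simp only: l1[OF uv] l2[OF uv(1) uv] l2[OF uv(2) uv])
  finally show ?thesis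
    using alt uv by simp
qed

lemma form_swap:
  assumes \<phi>: "sform q \<phi>" and uv: "u \<in> T x" "v \<in> T x"
  shows "\<phi> x (u # v # vs) = - \<phi> x (v # u # vs)"
proof (rule alternating_swap[OF uv, of "\<phi> x"])
  show "\<phi> x ((\<lambda>f. u f + w f) # vs) = \<phi> x (u # vs) + \<phi> x (w # vs)" if "u \<in> T x" "w \<in> T x" for u w vs
    using form_head_linear[OF \<phi> that, of 1 1] by simp
  show "\<phi> x (z # (\<lambda>f. u f + w f) # vs) = \<phi> x (z # u # vs) + \<phi> x (z # w # vs)"
    if "z \<in> T x" "u \<in> T x" "w \<in> T x" for z u w vs
    using form_head_linear[OF form_interior[OF \<phi> svf_extend[of x z]] that(2,3), of 1 1] that(1)
    by (simp add: interior_apply)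
  show "\<phi> x (v # v # vs) = 0" for v
    using form_head_twice[OF \<phi>] .
qed

text \<open>Made for induction on the degree: contractions control all slots after the first, so
  there remain linearity in the head and vanishing on two equal leading arguments.\<close>

lemma form_SucI:
  assumes nil: "\<And>x. \<phi> x [] = 0"
    and junk: "\<And>x v vs. v \<notin> T x \<Longrightarrow> \<phi> x (v # vs) = 0"
    and int: "\<And>A. svf A \<Longrightarrow> sform q (ii A \<phi>)"
    and lin: "\<And>x u w a b vs. u \<in> T x \<Longrightarrow> w \<in> T x \<Longrightarrow>
      \<phi> x ((\<lambda>f. a * u f + b * w f) # vs) = a * \<phi> x (u # vs) + b * \<phi> x (w # vs)"
    and alt: "\<And>x v vs. v \<in> T x \<Longrightarrow> \<phi> x (v # v # vs) = 0"
  shows "sform (Suc q) \<phi>"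
proof -
  have int': "sform q (ii (extend x v) \<phi>)" "ii (extend x v) \<phi> x vs = \<phi> x (v # vs)" if "v \<in> T x" for x v vs
    using int[OF svf_extend] that by (auto simp: interior_apply)
  have swap: "\<phi> x (u # v # vs) = - \<phi> x (v # u # vs)" if "u \<in> T x" "v \<in> T x" for x u v vs
  proof (rule alternating_swap[OF that, of "\<phi> x"])
    show "\<phi> x ((\<lambda>f. u f + w f) # vs) = \<phi> x (u # vs) + \<phi> x (w # vs)" if "u \<in> T x" "w \<in> T x" for u w vs
      using lin[OF that, of 1 1] by simp
    show "\<phi> x (z # (\<lambda>f. u f + w f) # vs) = \<phi> x (z # u # vs) + \<phi> x (z # w # vs)"
      if "z \<in> T x" "u \<in> T x" "w \<in> T x" for z u w vs
      using form_head_linear[OF int'(1)[OF that(1)] that(2,3), of 1 1] that(1) by (simp add: int'(2))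
  qed (rule alt)
  show ?thesis
    unfolding smooth_form_def
  proof (intro conjI allI impI)
    fix x vs
    assume j: "\<not> (length vs = Suc q \<and> set vs \<subseteq> T x)"
    show "\<phi> x vs = 0"
    proof (cases vs)
      case (Cons v ws)
      then show ?thesis
        using j junk[of v x ws] form_junk[OF int'(1), of v x ws x] int'(2)[of v x ws] by (cases "v \<in> T x") auto
    qed (use nil in simp)
  next
    fix x vs i u w and a b :: real
    assume l: "length vs = Suc q" "set vs \<subseteq> T x" "i < Suc q" and uw: "u \<in> T x" "w \<in> T x"
    obtain v ws where vs: "vs = v # ws" "length ws = q"
      using l(1) by (cases vs) auto
    then show "\<phi> x (vs[i := (\<lambda>f. a * u f + b * w f)]) = a * \<phi> x (vs[i := u]) + b * \<phi> x (vs[i := w])"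
      using form_multilinear[OF int'(1) vs(2) _ _ uw, of v x "i - 1" a b] int'(2)[of v x] l lin[OF uw]
      by (cases i) auto
  next
    fix x vs i j
    assume l: "length vs = Suc q" "set vs \<subseteq> T x" "i < j" "j < Suc q" "vs ! i = vs ! j"
    obtain v ws where vs: "vs = v # ws" "length ws = q" "v \<in> T x" "set ws \<subseteq> T x"
      using l(1,2) by (cases vs) auto
    obtain j' where j': "j = Suc j'"
      using l(3) by (cases j) auto
    show "\<phi> x vs = 0"
    proof (cases i)
      case (Suc i')
      then show ?thesis
        using form_alternating[OF int'(1)[OF vs(3)] vs(2,4), of i' j'] int'(2)[OF vs(3)] l vs(1) j' by auto
    next
      case 0
      then have v: "ws ! j' = v"
        using l(5) vs(1) j' by simp
      have "j' < q"
        using l(4) j' by simp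
      then obtain u us where ws: "ws = u # us"
        using vs(2) by (cases ws) auto
      show ?thesis
      proof (cases j')
        case 0
        then show ?thesis
          using v ws vs alt by simp
      next
        case (Suc k)
        \<comment> \<open>With \<open>u\<close> in front, both copies of \<open>v\<close> are
          arguments of the contraction by \<open>u\<close>, at positions 0 and \<open>j'\<close>;
          \<open>swap\<close> restores the original order.\<close>
        have "\<phi> x (u # v # us) = 0"
          using form_alternating[OF int'(1), of u x "v # us" x 0 j'] int'(2)[of u x "v # us"]
            vs ws v Suc \<open>j' < q\<close> by auto
        then show ?thesis
          using swap[of v x u us] vs ws by simp
      qed
    qed
  next
    fix Vs assume V: "length Vs = Suc q" "svfs Vs"
    then obtain A Ws where Vs: "Vs = A # Ws" "svf A" "svfs Ws"
      by (cases Vs) auto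
    have "smooth_at x (\<lambda>y. ii A \<phi> y (ev Ws y))" for x
      using form_smooth[OF int[OF Vs(2)] Vs(3)] .
    then show "smooth_fun_on \<A> UNIV (\<lambda>x. \<phi> x (ev Vs x))"
      unfolding smooth_fun_on_UNIV_iff by (simp add: Vs(1) interior_apply)
  qed
qed

lemma form_0I:
  assumes "\<And>x vs. vs \<noteq> [] \<Longrightarrow> \<phi> x vs = 0" "\<And>x. smooth_at x (\<lambda>y. \<phi> y [])"
  shows "sform 0 \<phi>"
  using assms unfolding smooth_form_def smooth_fun_on_UNIV_iff by auto

lemma form_0_eqI:
  assumes "sform 0 \<phi>" "sform 0 \<psi>" "\<And>x. \<phi> x [] = \<psi> x []"
  shows "\<phi> = \<psi>"
proof (intro ext)
  fix x vs
  show "\<phi> x vs = \<psi> x vs"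
    using assms(3) form_junk[OF assms(1), of vs x] form_junk[OF assms(2), of vs x] by (cases vs) auto
qed

text \<open>Each tangent vector is the value of a global field, so a form of positive degree is
  determined by its contractions. Identities thereby descend to lower degree.\<close>

lemma form_Suc_eqI:
  assumes \<phi>: "sform (Suc q) \<phi>" and \<psi>: "sform (Suc q) \<psi>" and "\<And>A. svf A \<Longrightarrow> ii A \<phi> = ii A \<psi>"
  shows "\<phi> = \<psi>"
proof (intro ext)
  fix x vs
  show "\<phi> x vs = \<psi> x vs"
  proof (cases "\<exists>v ws. vs = v # ws \<and> v \<in> T x")
    case True
    then obtain v ws where "vs = v # ws" "v \<in> T x"
      by blast
    then show ?thesis
      using fun_cong[OF fun_cong[OF assms(3)[OF svf_extend[of x v]]], of x ws] by (simp add: interior_apply)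
  next
    case False
    then have "\<not> (length vs = Suc q \<and> set vs \<subseteq> T x)"
      by (cases vs) auto
    then show ?thesis
      using form_junk[OF \<phi>] form_junk[OF \<psi>] by metis
  qed
qed

text \<open>One transposition for each entry passed. This reconciles the exterior derivative, which
  puts a bracket in front and omits entries, with the Lie derivative, which overwrites a
  slot.\<close>

lemma form_move_to_front:
  assumes "sform q \<phi>" "set vs \<subseteq> T x" "v \<in> T x" "j < length vs"
  shows "\<phi> x (v # nths vs (- {j})) = (-1) ^ j * \<phi> x (vs[j := v])"
  using assms
proof (induction vs arbitrary: q \<phi> j)
  case (Cons u us)
  show ?case
  proof (cases j)
    case 0
    have "{j. j \<noteq> 0 \<longrightarrow> True} = (UNIV :: nat set)" by auto
    then show ?thesis
      using 0 by (simp add: nths_Cons nths_all)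
  next
    case (Suc k)
    have "{j. Suc j \<in> - {Suc k}} = - {k}"
      by auto
    then have "\<phi> x (v # nths (u # us) (- {j})) = \<phi> x (v # u # nths us (- {k}))"
      using Suc by (simp add: nths_Cons)
    also have "\<dots> = - ii (extend x u) \<phi> x (v # nths us (- {k}))"
      using form_swap[OF Cons.prems(1), of v x u] Cons.prems by (simp add: interior_apply)
    also have "\<dots> = - ((-1) ^ k * ii (extend x u) \<phi> x (us[k := v]))"
      using Cons.IH[OF form_interior[OF Cons.prems(1) svf_extend], of k] Cons.prems Suc by simp
    finally show ?thesis
      using Suc Cons.prems by (simp add: interior_apply)
  qed
qed simp

section \<open>Lie brackets\<close>

lemma bracket_eval: "smooth_at x f \<Longrightarrow> bracket \<A> U V x f = U x (\<lambda>y. V y f) - V x (\<lambda>y. U y f)"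
  by (simp add: bracket_def)

lemma bracket_not_smooth: "\<not> smooth_at x f \<Longrightarrow> bracket \<A> U V x f = 0"
  by (simp add: bracket_def)

lemma bracket_combination:
  assumes A: "svf A" and UV: "svf U" "svf V"
  shows "bracket \<A> A (\<lambda>x f. a * U x f + b * V x f)
    = (\<lambda>x f. a * bracket \<A> A U x f + b * bracket \<A> A V x f)"
proof (intro ext)
  fix x f
  show "bracket \<A> A (\<lambda>x f. a * U x f + b * V x f) x f
    = a * bracket \<A> A U x f + b * bracket \<A> A V x f"
    by (cases "smooth_at x f")
       (simp_all add: bracket_eval bracket_not_smooth tangent_linear[OF svf_tangent[OF A]] svf_smooth UV
         algebra_simps)
qed

lemma bracket_flip: "bracket \<A> U V = (\<lambda>x f. - bracket \<A> V U x f)"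
  by (auto simp: bracket_def fun_eq_iff)

lemma bracket_combination_left:
  assumes "svf A" "svf U" "svf V"
  shows "bracket \<A> (\<lambda>x f. a * U x f + b * V x f) A
    = (\<lambda>x f. a * bracket \<A> U A x f + b * bracket \<A> V A x f)"
  unfolding bracket_flip[of _ A] bracket_combination[OF assms] by (simp add: fun_eq_iff)

text \<open>The arrangement is the one that arises when the commutator of two Lie derivatives is
  contracted with \<open>C\<close>.\<close>

lemma jacobi:
  assumes A: "svf A" and B: "svf B" and C: "svf C"
  shows "bracket \<A> (bracket \<A> A B) C
    = (\<lambda>x f. bracket \<A> A (bracket \<A> B C) x f - bracket \<A> B (bracket \<A> A C) x f)"
proof (intro ext)
  fix x f
  have inner: "Z x (\<lambda>y. bracket \<A> U V y f) = Z x (\<lambda>y. U y (\<lambda>z. V z f)) - Z x (\<lambda>y. V y (\<lambda>z. U z f))"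
    if Z: "svf Z" and U: "svf U" and V: "svf V" and f: "smooth_at x f" for Z U V
  proof -
    obtain W where W: "open W" "x \<in> W" "\<forall>y\<in>W. smooth_at y f"
      using smooth_at_open[OF f] by blast
    have "Z x (\<lambda>y. bracket \<A> U V y f) = Z x (\<lambda>y. U y (\<lambda>z. V z f) - V y (\<lambda>z. U z f))"
      by (rule tangent_cong[OF svf_tangent[OF Z] W(1,2)]) (simp add: bracket_eval W(3))
    then show ?thesis
      using tangent_diff[OF svf_tangent[OF Z] svf_smooth[OF U svf_smooth[OF V f]] svf_smooth[OF V svf_smooth[OF U f]]]
      by simp
  qed
  show "bracket \<A> (bracket \<A> A B) C x f
    = bracket \<A> A (bracket \<A> B C) x f - bracket \<A> B (bracket \<A> A C) x f"
  proof (cases "smooth_at x f")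
    case True
    then show ?thesis
      by (simp add: bracket_eval inner A B C svf_smooth)
  qed (simp add: bracket_not_smooth)
qed


section \<open>Lie derivative\<close>

definition FL :: "'a vfield \<Rightarrow> 'a form \<Rightarrow> 'a vfield list \<Rightarrow> 'a \<Rightarrow> real"
  where "FL A \<phi> = (\<lambda>Vs x. A x (\<lambda>y. \<phi> y (ev Vs y)) -
    (\<Sum>j<length Vs. \<phi> x ((ev Vs x)[j := bracket \<A> A (Vs ! j) x])))"

abbreviation L :: "'a vfield \<Rightarrow> 'a form \<Rightarrow> 'a form"
  where "L \<equiv> lie_derivative \<A>"

lemma L_eq_tensorial: "L A \<phi> = tensorial \<A> (FL A \<phi>)"
  by (simp add: lie_derivative_def FL_def)

lemma FL_Nil: "FL A \<phi> [] x = A x (\<lambda>y. \<phi> y [])"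
  by (simp add: FL_def)

text \<open>Splitting off the correction in slot 0 gives i_B L_A = L_A i_B - i_[A,B] on lists of
  fields, before L_A is known to be pointwise.\<close>

lemma FL_Cons: "FL A \<phi> (B # Vs) x = FL A (ii B \<phi>) Vs x - \<phi> x (bracket \<A> A B x # ev Vs x)"
  unfolding FL_def by (simp add: sum.lessThan_Suc_shift interior_apply del: sum.lessThan_Suc)

lemma FL_form_linear:
  assumes "svf A" "svfs Vs" "sform q \<phi>" "sform q \<psi>"
  shows "FL A (\<lambda>x vs. a * \<phi> x vs + b * \<psi> x vs) Vs x = a * FL A \<phi> Vs x + b * FL A \<psi> Vs x"
  using tangent_linear[OF svf_tangent[OF assms(1)] form_smooth[OF assms(3,2)] form_smooth[OF assms(4,2)]]
  by (simp add: FL_def sum.distrib sum_distrib_left algebra_simps)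

lemma interior_combination:
  assumes "sform q \<phi>" "svf U" "svf V"
  shows "ii (\<lambda>x f. a * U x f + b * V x f) \<phi> = (\<lambda>x vs. a * ii U \<phi> x vs + b * ii V \<phi> x vs)"
  using form_head_linear[OF assms(1)] svf_tangent assms(2,3) by (simp add: fun_eq_iff interior_apply)

lemma FL_head_linear:
  assumes A: "svf A" and UV: "svf U" "svf V" and Vs: "svfs Vs" and \<phi>: "sform q \<phi>"
  shows "FL A \<phi> ((\<lambda>x f. a * U x f + b * V x f) # Vs) x = a * FL A \<phi> (U # Vs) x + b * FL A \<phi> (V # Vs) x"
  unfolding FL_Cons interior_combination[OF \<phi> UV] bracket_combination[OF A UV]
    FL_form_linear[OF A Vs form_interior[OF \<phi> UV(1)] form_interior[OF \<phi> UV(2)]]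
    form_head_linear[OF \<phi> svf_tangent[OF svf_bracket[OF A UV(1)]] svf_tangent[OF svf_bracket[OF A UV(2)]]]
  by (simp add: algebra_simps)

text \<open>Write C as the sum of a_j E_j with E_j = X(.)(j-th unit vector) and a_j(x) = 0. At x,
  differentiating the value of the form on C and forming [A,C] both leave the coefficients A(a_j) on
  E_j, so these two terms cancel; the other corrections have C(x) = 0 in the head.\<close>

lemma FL_head_zero:
  assumes A: "svf A" and C: "svf C" and Vs: "svfs Vs" and \<phi>: "sform q \<phi>" and zero: "C x = (\<lambda>f. 0)"
  shows "FL A \<phi> (C # Vs) x = 0"
proof -
  define a where "a = (\<lambda>j y. Y y (C y) $ j)"
  define E where "E = (\<lambda>j y. X y (axis j 1))"
  have a: "smooth_at x (a j)" "a j x = 0" for j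
    unfolding a_def by (rule smooth_adjoint_map[OF C], simp add: zero adjoint_map_zero)
  have E: "svf (E j)" for j
    unfolding E_def by (rule X_smooth)
  have C_sum: "C y = (\<lambda>f. \<Sum>j\<in>UNIV. a j y * E j y f)" for y
    using X_axis_sum[of y "Y y (C y)"] svf_tangent[OF C] by (simp add: a_def E_def fun_eq_iff)
  note Ax = svf_tangent[OF A, of x]
  have sm: "smooth_at x (\<lambda>y. \<phi> y (E j y # ev Vs y))" for j
    using form_smooth[OF \<phi>, of "E j # Vs"] Vs E by simp
  have "A x (\<lambda>y. \<phi> y (C y # ev Vs y)) = A x (\<lambda>y. \<Sum>j\<in>UNIV. a j y * \<phi> y (E j y # ev Vs y))"
    by (subst C_sum) (simp add: form_head_sum[OF \<phi>] svf_tangent[OF E])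
  also have "\<dots> = (\<Sum>j\<in>UNIV. A x (a j) * \<phi> x (E j x # ev Vs x))"
    by (subst tangent_sum[OF Ax]) (auto intro!: smooth_at_mult a sm simp: tangent_mult[OF Ax a(1) sm] a(2) mult.commute)
  also have "\<dots> = \<phi> x (bracket \<A> A C x # ev Vs x)"
  proof -
    have "bracket \<A> A C x f = (\<Sum>j\<in>UNIV. A x (a j) * E j x f)" for f
    proof (cases "smooth_at x f")
      case True
      have Ef: "smooth_at x (\<lambda>y. E j y f)" for j
        using svf_smooth[OF E True] .
      have "bracket \<A> A C x f = A x (\<lambda>y. C y f)"
        by (simp add: bracket_eval[OF True] zero)
      also have "\<dots> = A x (\<lambda>y. \<Sum>j\<in>UNIV. a j y * E j y f)"
        by (subst C_sum) simp
      also have "\<dots> = (\<Sum>j\<in>UNIV. A x (a j) * E j x f)"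
        by (subst tangent_sum[OF Ax]) (auto intro!: smooth_at_mult a Ef simp: tangent_mult[OF Ax a(1) Ef] a(2) mult.commute)
      finally show ?thesis .
    next
      case False
      then show ?thesis
        using tangent_not_smooth[OF svf_tangent[OF E] False] by (simp add: bracket_not_smooth)
    qed
    then have "bracket \<A> A C x = (\<lambda>f. \<Sum>j\<in>UNIV. A x (a j) * E j x f)"
      by blast
    then show ?thesis
      by (simp add: form_head_sum[OF \<phi>] svf_tangent[OF E])
  qed
  finally have "A x (\<lambda>y. \<phi> y (C y # ev Vs y)) = \<phi> x (bracket \<A> A C x # ev Vs x)" .
  then show ?thesis
    unfolding FL_Cons by (simp add: FL_def interior_apply zero form_head_zero[OF \<phi>])
qed

lemma FL_head_cong:
  assumes "svf A" "svf U" "svf V" "svfs Vs" "sform q \<phi>" and eq: "U x = V x"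
  shows "FL A \<phi> (U # Vs) x = FL A \<phi> (V # Vs) x"
  using FL_head_zero[OF assms(1) svf_combination[OF assms(2,3), of 1 "-1"] assms(4,5), of x]
    FL_head_linear[OF assms(1-5), of 1 "-1" x] eq by simp

lemma FL_cong:
  assumes "svf A" "svfs Vs" "svfs Vs'" "sform q \<phi>" "ev Vs x = ev Vs' x"
  shows "FL A \<phi> Vs x = FL A \<phi> Vs' x"
  using assms(2-)
proof (induction Vs arbitrary: Vs' q \<phi>)
  case (Cons U Us)
  then obtain V Ws where V: "Vs' = V # Ws" "svf V" "svfs Ws" "U x = V x" "ev Us x = ev Ws x"
    by auto
  have "FL A \<phi> (U # Us) x = FL A \<phi> (U # Ws) x"
    using Cons.IH[OF _ V(3) form_interior[OF Cons.prems(3), of U]] Cons.prems V by (simp add: FL_Cons)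
  also have "\<dots> = FL A \<phi> (V # Ws) x"
    by (rule FL_head_cong[OF assms(1)]) (use Cons.prems V in auto)
  finally show ?case
    using V by simp
qed simp

lemma tensorial_eval:
  assumes "svfs Vs" "\<And>Ws. svfs Ws \<Longrightarrow> ev Ws x = ev Vs x \<Longrightarrow> F Ws x = F Vs x"
  shows "tensorial \<A> F x (ev Vs x) = F Vs x"
proof -
  have "(THE r. \<forall>Ws. svfs Ws \<longrightarrow> ev Ws x = ev Vs x \<longrightarrow> F Ws x = r) = F Vs x"
  proof (rule the_equality)
    show "r = F Vs x" if "\<forall>Ws. svfs Ws \<longrightarrow> ev Ws x = ev Vs x \<longrightarrow> F Ws x = r" for r
      using that assms(1) by blast
  qed (use assms(2) in blast)
  then show ?thesis
    using ev_tangent[OF assms(1)] by (simp add: tensorial_def)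
qed

lemma tensorial_junk: "\<not> set vs \<subseteq> T x \<Longrightarrow> tensorial \<A> F x vs = 0"
  by (auto simp: tensorial_def)

lemma L_eval: "sform q \<phi> \<Longrightarrow> svf A \<Longrightarrow> svfs Vs \<Longrightarrow> L A \<phi> x (ev Vs x) = FL A \<phi> Vs x"
  unfolding L_eq_tensorial by (rule tensorial_eval) (auto intro: FL_cong)

lemma L_Nil: "sform q \<phi> \<Longrightarrow> svf A \<Longrightarrow> L A \<phi> x [] = A x (\<lambda>y. \<phi> y [])"
  using L_eval[of q \<phi> A "[]" x] by (simp add: FL_Nil)

lemma form_eqI:
  fixes \<phi> \<psi> :: "'a form"
  assumes "\<And>x vs. \<not> set vs \<subseteq> T x \<Longrightarrow> \<phi> x vs = \<psi> x vs" "\<And>x Vs. svfs Vs \<Longrightarrow> \<phi> x (ev Vs x) = \<psi> x (ev Vs x)"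
  shows "\<phi> = \<psi>"
proof (intro ext)
  fix x vs
  show "\<phi> x vs = \<psi> x vs"
  proof (cases "set vs \<subseteq> T x")
    case True
    then obtain Vs where "svfs Vs" "ev Vs x = vs"
      using extend_list by blast
    then show ?thesis
      using assms(2)[of Vs x] by simp
  qed (use assms(1) in auto)
qed

lemma L_junk: "\<not> set vs \<subseteq> T x \<Longrightarrow> L A \<phi> x vs = 0"
  unfolding L_eq_tensorial by (rule tensorial_junk)

lemma interior_L:
  assumes \<phi>: "sform q \<phi>" and A: "svf A" and B: "svf B"
  shows "ii B (L A \<phi>) = (\<lambda>x vs. L A (ii B \<phi>) x vs - ii (bracket \<A> A B) \<phi> x vs)"
proof (rule form_eqI)
  fix x vs assume "\<not> set vs \<subseteq> T x"
  then show "ii B (L A \<phi>) x vs = L A (ii B \<phi>) x vs - ii (bracket \<A> A B) \<phi> x vs"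
    by (simp add: interior_apply L_junk form_junk[OF \<phi>])
next
  fix x Vs assume Vs: "svfs Vs"
  then show "ii B (L A \<phi>) x (ev Vs x) = L A (ii B \<phi>) x (ev Vs x) - ii (bracket \<A> A B) \<phi> x (ev Vs x)"
    using L_eval[OF \<phi> A, of "B # Vs" x] L_eval[OF form_interior[OF \<phi> B] A Vs] B
    by (simp add: interior_apply FL_Cons)
qed

lemma L_linear:
  assumes "sform q \<phi>" "sform q \<psi>" "svf A"
  shows "L A (\<lambda>x vs. a * \<phi> x vs + b * \<psi> x vs) = (\<lambda>x vs. a * L A \<phi> x vs + b * L A \<psi> x vs)"
  by (rule form_eqI)
     (simp_all add: L_junk L_eval[OF form_combination[OF assms(1,2)] assms(3)]
       L_eval[OF assms(1,3)] L_eval[OF assms(2,3)] FL_form_linear[OF assms(3) _ assms(1,2)])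

lemma L_zero: "svf A \<Longrightarrow> L A (\<lambda>x vs. 0) = (\<lambda>x vs. 0)"
  using L_linear[OF form_zero form_zero, of A 0 0] by simp

lemma L_diff:
  "sform q \<phi> \<Longrightarrow> sform q \<psi> \<Longrightarrow> svf A \<Longrightarrow> L A (\<lambda>x vs. \<phi> x vs - \<psi> x vs) = (\<lambda>x vs. L A \<phi> x vs - L A \<psi> x vs)"
  using L_linear[of q \<phi> \<psi> A 1 "-1"] by simp

text \<open>By i_B L_A = L_A i_B - i_[A,B], contractions involve Lie derivatives of lower degree
  only, so the induction hypothesis covers all slots but the head.\<close>

lemma sform_L: "sform q \<phi> \<Longrightarrow> svf A \<Longrightarrow> sform q (L A \<phi>)"
proof (induction q arbitrary: \<phi>)
  case 0
  show ?case
  proof (rule form_0I)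
    fix x and vs :: "'a tangent list" assume vs: "vs \<noteq> []"
    show "L A \<phi> x vs = 0"
    proof (cases "set vs \<subseteq> T x")
      case True
      then obtain Vs where Vs: "svfs Vs" "ev Vs x = vs"
        using extend_list by blast
      have "FL A \<phi> Vs x = A x (\<lambda>y. 0)"
        using vs Vs(2) form_junk[OF "0.prems"(1)] unfolding FL_def by (cases Vs) auto
      then show ?thesis
        using L_eval[OF 0 Vs(1), of x] Vs(2) tangent_const[OF svf_tangent[OF "0.prems"(2)]] by simp
    qed (rule L_junk)
  next
    fix x
    show "smooth_at x (\<lambda>y. L A \<phi> y [])"
      unfolding L_Nil[OF 0] using svf_smooth[OF 0(2)] form_smooth[OF 0(1), of "[]"] by simp
  qed
next
  case (Suc q)
  note \<phi> = Suc.prems(1) and A = Suc.prems(2)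
  show ?case
  proof (rule form_SucI)
    show "L A \<phi> x [] = 0" for x
      using L_Nil[OF \<phi> A] form_junk[OF \<phi>] tangent_const[OF svf_tangent[OF A]] by simp
    show "L A \<phi> x (v # vs) = 0" if "v \<notin> T x" for x v vs
      using that by (intro L_junk) auto
    show "sform q (ii B (L A \<phi>))" if B: "svf B" for B
      unfolding interior_L[OF \<phi> A B]
      by (intro form_diff Suc.IH form_interior_Suc \<phi> A B svf_bracket)
    show "L A \<phi> x ((\<lambda>f. a * u f + b * w f) # vs) = a * L A \<phi> x (u # vs) + b * L A \<phi> x (w # vs)"
      if uw: "u \<in> T x" "w \<in> T x" for x u w a b vs
    proof -
      let ?U = "extend x u" and ?W = "extend x w"
      let ?V = "\<lambda>x f. a * ?U x f + b * ?W x f"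
      note UW = svf_extend[of x u] svf_extend[of x w]
      have "ii ?V (L A \<phi>) x vs = a * ii ?U (L A \<phi>) x vs + b * ii ?W (L A \<phi>) x vs"
        unfolding interior_L[OF \<phi> A svf_combination[OF UW]] interior_L[OF \<phi> A UW(1)] interior_L[OF \<phi> A UW(2)]
          interior_combination[OF \<phi> UW] bracket_combination[OF A UW]
          interior_combination[OF \<phi> svf_bracket[OF A UW(1)] svf_bracket[OF A UW(2)]]
          L_linear[OF form_interior[OF \<phi> UW(1)] form_interior[OF \<phi> UW(2)] A]
        by (simp add: algebra_simps)
      then show ?thesis
        using uw by (simp add: interior_apply)
    qed
    show "L A \<phi> x (v # v # vs) = 0" if v: "v \<in> T x" for x v vs
    proof -
      let ?V = "extend x v"
      note V = svf_extend[of x v]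
      note AV = svf_bracket[OF A V]
      \<comment> \<open>Since i_V i_V kills the form, i_V L_A i_V reduces to - i_[A,V] i_V; the
        other term i_V i_[A,V] equals the same thing by antisymmetry, and the two are
        subtracted.\<close>
      have "ii ?V (ii ?V \<phi>) = (\<lambda>x vs. 0)"
        using form_head_twice[OF \<phi>] by (simp add: interior_apply fun_eq_iff)
      then have "ii ?V (L A (ii ?V \<phi>)) x vs = - ii (bracket \<A> A ?V) (ii ?V \<phi>) x vs"
        using interior_L[OF form_interior[OF \<phi> V] A V] L_zero[OF A] by simp
      moreover have "ii ?V (ii (bracket \<A> A ?V) \<phi>) x vs = - ii (bracket \<A> A ?V) (ii ?V \<phi>) x vs"
        using form_swap[OF \<phi> svf_tangent[OF AV] svf_tangent[OF V]] by (simp add: interior_apply)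
      moreover have "ii ?V (ii ?V (L A \<phi>)) x vs
          = ii ?V (L A (ii ?V \<phi>)) x vs - ii ?V (ii (bracket \<A> A ?V) \<phi>) x vs"
        unfolding interior_L[OF \<phi> A V] by (simp add: interior_apply)
      ultimately show ?thesis
        using v by (simp add: interior_apply)
    qed
  qed
qed

text \<open>Only constant coefficients are allowed, as L_A differentiates A. Through Cartan's
  formula this gives linearity of the exterior derivative in its first argument.\<close>

lemma L_field_linear:
  assumes \<phi>: "sform q \<phi>" and AB: "svf A" "svf B"
  shows "L (\<lambda>x f. a * A x f + b * B x f) \<phi> = (\<lambda>x vs. a * L A \<phi> x vs + b * L B \<phi> x vs)"
proof (rule form_eqI)
  fix x Vs assume Vs: "svfs Vs"
  have lin: "\<phi> x ((ev Vs x)[j := (\<lambda>f. a * u f + b * v f)]) = a * \<phi> x ((ev Vs x)[j := u]) + b * \<phi> x ((ev Vs x)[j := v])"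
    if "u \<in> T x" "v \<in> T x" "j < length Vs" for u v j
  proof (cases "length Vs = q")
    case True
    then show ?thesis
      using form_multilinear[OF \<phi> _ ev_tangent[OF Vs]] that by simp
  qed (simp add: form_junk[OF \<phi>])
  have "(\<Sum>j<length Vs. \<phi> x ((ev Vs x)[j := bracket \<A> (\<lambda>x f. a * A x f + b * B x f) (Vs ! j) x]))
      = (\<Sum>j<length Vs. a * \<phi> x ((ev Vs x)[j := bracket \<A> A (Vs ! j) x])
          + b * \<phi> x ((ev Vs x)[j := bracket \<A> B (Vs ! j) x]))"
    by (rule sum.cong[OF refl], subst bracket_combination_left, use Vs AB in simp_all, rule lin)
       (use Vs AB svf_tangent[OF svf_bracket] in auto)
  then have "FL (\<lambda>x f. a * A x f + b * B x f) \<phi> Vs x = a * FL A \<phi> Vs x + b * FL B \<phi> Vs x"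
    unfolding FL_def by (simp add: sum.distrib sum_distrib_left algebra_simps)
  then show "L (\<lambda>x f. a * A x f + b * B x f) \<phi> x (ev Vs x) = a * L A \<phi> x (ev Vs x) + b * L B \<phi> x (ev Vs x)"
    by (simp add: L_eval[OF \<phi>] Vs AB svf_combination)
qed (simp add: L_junk)

text \<open>After contraction with C the mixed terms L_A i_[B,C] and L_B i_[A,C] cancel, the
  induction hypothesis treats i_C, and the Jacobi identity matches the iterated brackets. In degree
  0 the claim is the definition of the bracket.\<close>

lemma L_bracket:
  assumes A: "svf A" and B: "svf B"
  shows "sform q \<phi> \<Longrightarrow> L (bracket \<A> A B) \<phi> = (\<lambda>x vs. L A (L B \<phi>) x vs - L B (L A \<phi>) x vs)"
proof (induction q arbitrary: \<phi>)
  case 0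
  note AB = svf_bracket[OF A B]
  note S = sform_L[OF 0 A] sform_L[OF 0 B]
  show ?case
  proof (rule form_0_eqI)
    show "sform 0 (\<lambda>x vs. L A (L B \<phi>) x vs - L B (L A \<phi>) x vs)"
      by (intro form_diff sform_L S A B)
    show "L (bracket \<A> A B) \<phi> x [] = L A (L B \<phi>) x [] - L B (L A \<phi>) x []" for x
      using L_Nil[OF 0 AB] L_Nil[OF S(1) B] L_Nil[OF S(2) A] L_Nil[OF 0 A] L_Nil[OF 0 B]
        bracket_eval[OF form_smooth[OF 0, of "[]" x]] by simp
  qed (rule sform_L[OF 0 AB])
next
  case (Suc q)
  note \<phi> = Suc.prems
  note AB = svf_bracket[OF A B]
  show ?case
  proof (rule form_Suc_eqI)
    show "sform (Suc q) (\<lambda>x vs. L A (L B \<phi>) x vs - L B (L A \<phi>) x vs)"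
      by (intro form_diff sform_L \<phi> A B)
    show "sform (Suc q) (L (bracket \<A> A B) \<phi>)"
      by (rule sform_L[OF \<phi> AB])
    fix C assume C: "svf C"
    have LL: "ii C (L U (L V \<phi>)) = (\<lambda>x vs. L U (L V (ii C \<phi>)) x vs - L U (ii (bracket \<A> V C) \<phi>) x vs
        - (L V (ii (bracket \<A> U C) \<phi>) x vs - ii (bracket \<A> V (bracket \<A> U C)) \<phi> x vs))"
      if U: "svf U" and V: "svf V" for U V
      unfolding interior_L[OF sform_L[OF \<phi> V] U C] interior_L[OF \<phi> V C] interior_L[OF \<phi> V svf_bracket[OF U C]]
        L_diff[OF sform_L[OF form_interior_Suc[OF \<phi> C] V] form_interior_Suc[OF \<phi> svf_bracket[OF V C]] U] ..
    have J: "ii (bracket \<A> (bracket \<A> A B) C) \<phi>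
        = (\<lambda>x vs. ii (bracket \<A> A (bracket \<A> B C)) \<phi> x vs - ii (bracket \<A> B (bracket \<A> A C)) \<phi> x vs)"
      using interior_combination[OF \<phi> svf_bracket[OF A svf_bracket[OF B C]] svf_bracket[OF B svf_bracket[OF A C]], of 1 "-1"]
      unfolding jacobi[OF A B C] by simp
    have "ii C (\<lambda>x vs. L A (L B \<phi>) x vs - L B (L A \<phi>) x vs)
        = (\<lambda>x vs. ii C (L A (L B \<phi>)) x vs - ii C (L B (L A \<phi>)) x vs)"
      by (simp add: interior_product_def)
    then show "ii C (L (bracket \<A> A B) \<phi>) = ii C (\<lambda>x vs. L A (L B \<phi>) x vs - L B (L A \<phi>) x vs)"
      unfolding LL[OF A B] LL[OF B A] interior_L[OF \<phi> AB C] J Suc.IH[OF form_interior_Suc[OF \<phi> C]]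
      by (simp add: fun_eq_iff)
  qed
qed


section \<open>Exterior derivative\<close>

definition Fd :: "'a form \<Rightarrow> 'a vfield list \<Rightarrow> 'a \<Rightarrow> real"
  where "Fd \<phi> = (\<lambda>Vs x.
    (\<Sum>i<length Vs. (-1) ^ i * (Vs ! i) x (\<lambda>y. \<phi> y (ev (nths Vs (- {i})) y))) +
    (\<Sum>j<length Vs. \<Sum>i<j. (-1) ^ (i + j) *
       \<phi> x (bracket \<A> (Vs ! i) (Vs ! j) x # ev (nths Vs (- {i, j})) x)))"

abbreviation d :: "'a form \<Rightarrow> 'a form"
  where "d \<equiv> ext_derivative \<A>"

lemma d_eq_tensorial: "d \<phi> = tensorial \<A> (Fd \<phi>)"
  by (simp add: ext_derivative_def Fd_def)

lemma nths_omit: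
  "nths (v # vs) (- {0}) = vs"
  "nths (v # vs) (- {Suc i}) = v # nths vs (- {i})"
  "nths (v # vs) (- {0, Suc j}) = nths vs (- {j})"
  "nths (v # vs) (- {Suc i, Suc j}) = v # nths vs (- {i, j})"
proof -
  have "{k. Suc k \<in> - {0}} = (UNIV :: nat set)" "{k. Suc k \<in> - {Suc i}} = - {i}"
    "{k. Suc k \<in> - {0, Suc j}} = - {j}" "{k. Suc k \<in> - {Suc i, Suc j}} = - {i, j}"
    by auto
  then show "nths (v # vs) (- {0}) = vs" "nths (v # vs) (- {Suc i}) = v # nths vs (- {i})"
    "nths (v # vs) (- {0, Suc j}) = nths vs (- {j})"
    "nths (v # vs) (- {Suc i, Suc j}) = v # nths vs (- {i, j})"
    unfolding nths_Cons by (simp_all add: nths_all)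
qed

lemma Fd_Nil: "Fd \<phi> [] x = 0"
  by (simp add: Fd_def)

text \<open>Cartan's formula for the defining expressions: a recursion that makes the double sum dispensable.\<close>

lemma Fd_Cons:
  assumes \<phi>: "sform q \<phi>" and A: "svf A" and Vs: "svfs Vs"
  shows "Fd \<phi> (A # Vs) x = FL A \<phi> Vs x - Fd (ii A \<phi>) Vs x"
proof -
  let ?n = "length Vs"
  let ?G = "\<lambda>i j. (-1) ^ (i + j) * \<phi> x (bracket \<A> ((A # Vs) ! i) ((A # Vs) ! j) x # ev (nths (A # Vs) (- {i, j})) x)"
  let ?H = "\<lambda>i j. (-1) ^ (i + j) * ii A \<phi> x (bracket \<A> (Vs ! i) (Vs ! j) x # ev (nths Vs (- {i, j})) x)"
  have V: "svf (Vs ! j)" if "j < ?n" for j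
    using Vs that by simp
  have first: "(\<Sum>i<Suc ?n. (-1) ^ i * ((A # Vs) ! i) x (\<lambda>y. \<phi> y (ev (nths (A # Vs) (- {i})) y)))
      = A x (\<lambda>y. \<phi> y (ev Vs y)) - (\<Sum>i<?n. (-1) ^ i * (Vs ! i) x (\<lambda>y. ii A \<phi> y (ev (nths Vs (- {i})) y)))"
    by (simp only: sum.lessThan_Suc_shift) (simp add: nths_omit interior_apply sum_negf)
  \<comment> \<open>The sign is \<open>(-1) ^ Suc j\<close>, and taking the bracket from the front
    to slot \<open>j\<close> costs \<open>(-1) ^ j\<close>: what is left is minus the j-th
    correction of \<open>FL\<close>.\<close>
  have G0: "?G 0 (Suc j) = - \<phi> x ((ev Vs x)[j := bracket \<A> A (Vs ! j) x])" if j: "j < ?n" for j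
  proof -
    have "?G 0 (Suc j) = - ((-1) ^ j * \<phi> x (bracket \<A> A (Vs ! j) x # nths (ev Vs x) (- {j})))"
      by (simp add: nths_omit nths_map)
    also have "\<dots> = - ((-1) ^ j * ((-1) ^ j * \<phi> x ((ev Vs x)[j := bracket \<A> A (Vs ! j) x])))"
      by (subst form_move_to_front[OF \<phi> ev_tangent[OF Vs] svf_tangent[OF svf_bracket[OF A V[OF j]]]])
         (simp_all add: j)
    also have "\<dots> = - \<phi> x ((ev Vs x)[j := bracket \<A> A (Vs ! j) x])"
      by (simp add: power_mult_distrib[symmetric] mult.assoc[symmetric])
    finally show ?thesis .
  qed
  \<comment> \<open>Raising both indices keeps the sign; the minus comes from exchanging the bracket
    with \<open>A\<close> to obtain a contraction.\<close>
  have GS: "?G (Suc i) (Suc j) = - ?H i j" if "j < ?n" "i < j" for i j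
  proof -
    have "\<phi> x (bracket \<A> (Vs ! i) (Vs ! j) x # A x # vs) = - \<phi> x (A x # bracket \<A> (Vs ! i) (Vs ! j) x # vs)" for vs
      using form_swap[OF \<phi> svf_tangent[OF svf_bracket[OF V V]] svf_tangent[OF A]] that by simp
    then show ?thesis
      by (simp add: nths_omit interior_apply)
  qed
  have "(\<Sum>j<Suc ?n. \<Sum>i<j. ?G i j) = (\<Sum>j<?n. ?G 0 (Suc j) + (\<Sum>i<j. ?G (Suc i) (Suc j)))"
    by (simp only: sum.lessThan_Suc_shift lessThan_0 sum.empty add_0)
  also have "\<dots> = (\<Sum>j<?n. - \<phi> x ((ev Vs x)[j := bracket \<A> A (Vs ! j) x]) + (\<Sum>i<j. - ?H i j))"
  proof (rule sum.cong[OF refl])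
    fix j assume "j \<in> {..<?n}"
    then have j: "j < ?n" by simp
    have "(\<Sum>i<j. ?G (Suc i) (Suc j)) = (\<Sum>i<j. - ?H i j)"
      by (rule sum.cong[OF refl]) (use GS[OF j] in blast)
    then show "?G 0 (Suc j) + (\<Sum>i<j. ?G (Suc i) (Suc j))
        = - \<phi> x ((ev Vs x)[j := bracket \<A> A (Vs ! j) x]) + (\<Sum>i<j. - ?H i j)"
      unfolding G0[OF j] by simp
  qed
  also have "\<dots> = - (\<Sum>j<?n. \<phi> x ((ev Vs x)[j := bracket \<A> A (Vs ! j) x])) - (\<Sum>j<?n. \<Sum>i<j. ?H i j)"
    by (simp add: sum_subtractf sum_negf)
  finally show ?thesis
    unfolding Fd_def FL_def using first by simp
qed

lemma Fd_linear:
  assumes "sform q \<phi>" "sform q \<psi>" "svfs Vs"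
  shows "Fd (\<lambda>x vs. a * \<phi> x vs + b * \<psi> x vs) Vs x = a * Fd \<phi> Vs x + b * Fd \<psi> Vs x"
  using assms
proof (induction Vs arbitrary: q \<phi> \<psi>)
  case (Cons A Vs)
  have A: "svf A" and Vs: "svfs Vs"
    using Cons.prems(3) by auto
  note \<phi> = Cons.prems(1) and \<psi> = Cons.prems(2)
  have "ii A (\<lambda>x vs. a * \<phi> x vs + b * \<psi> x vs) = (\<lambda>x vs. a * ii A \<phi> x vs + b * ii A \<psi> x vs)"
    by (simp add: interior_product_def)
  then show ?case
    using Cons.IH[OF form_interior[OF \<phi> A] form_interior[OF \<psi> A] Vs]
    by (simp add: Fd_Cons[OF \<phi> A Vs] Fd_Cons[OF \<psi> A Vs] Fd_Cons[OF form_combination[OF \<phi> \<psi>] A Vs]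
        FL_form_linear[OF A Vs \<phi> \<psi>] algebra_simps)
qed (simp add: Fd_Nil)

text \<open>Two steps of the recursion give FL A (i_B) - FL B (i_A) - (contraction by [A,B]) + Fd
  (i_B i_A), which is visibly antisymmetric in A and B.\<close>

lemma Fd_swap:
  assumes \<phi>: "sform q \<phi>" and A: "svf A" and B: "svf B" and Vs: "svfs Vs"
  shows "Fd \<phi> (A # B # Vs) x = - Fd \<phi> (B # A # Vs) x"
proof -
  have expand: "Fd \<phi> (U # V # Vs) x = FL U \<phi> (V # Vs) x - (FL V (ii U \<phi>) Vs x - Fd (ii V (ii U \<phi>)) Vs x)"
    if U: "svf U" and V: "svf V" for U V
    using Fd_Cons[OF \<phi> U, of "V # Vs"] Fd_Cons[OF form_interior[OF \<phi> U] V Vs] V Vs by simp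
  \<comment> \<open>The trivial summand with coefficient 0 casts the sign change as a combination to
    which \<open>Fd_linear\<close> applies.\<close>
  have "ii B (ii A \<phi>) = (\<lambda>x vs. (-1) * ii A (ii B \<phi>) x vs + 0 * ii A (ii B \<phi>) x vs)"
    using form_swap[OF \<phi> svf_tangent[OF A] svf_tangent[OF B]] by (simp add: fun_eq_iff interior_apply)
  moreover have "sform (q - 1 - 1) (ii A (ii B \<phi>))"
    by (intro form_interior \<phi> A B)
  ultimately have "Fd (ii B (ii A \<phi>)) Vs x = - Fd (ii A (ii B \<phi>)) Vs x"
    using Fd_linear[of "q - 1 - 1" "ii A (ii B \<phi>)" "ii A (ii B \<phi>)" Vs "-1" 0] Vs by simp
  moreover have "\<phi> x (bracket \<A> A B x # ev Vs x) = - \<phi> x (bracket \<A> B A x # ev Vs x)"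
    using form_head_linear[OF \<phi> svf_tangent[OF svf_bracket[OF B A]] tangent_zero, of x "-1" 0]
    by (subst bracket_flip) simp
  ultimately show ?thesis
    unfolding expand[OF A B] expand[OF B A] FL_Cons by simp
qed

lemma Fd_tail_cong:
  assumes \<phi>: "sform q \<phi>" and A: "svf A" and Vs: "svfs Vs" "svfs Ws" "ev Vs x = ev Ws x"
    and IH: "Fd (ii A \<phi>) Vs x = Fd (ii A \<phi>) Ws x"
  shows "Fd \<phi> (A # Vs) x = Fd \<phi> (A # Ws) x"
  unfolding Fd_Cons[OF \<phi> A Vs(1)] Fd_Cons[OF \<phi> A Vs(2)] IH FL_cong[OF A Vs(1,2) \<phi> Vs(3)] ..

text \<open>With the head fixed, the recursion allows the tail to be changed. The head cannot be
  changed this way, as \<open>FL\<close> differentiates its field, so it is first swapped into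
  second place. The swapped tail is no sublist, hence induction on the length.\<close>

lemma Fd_cong:
  assumes "sform q \<phi>" "svfs Vs" "svfs Ws" "ev Vs x = ev Ws x"
  shows "Fd \<phi> Vs x = Fd \<phi> Ws x"
  using assms
proof (induction "length Vs" arbitrary: Vs Ws q \<phi>)
  case 0
  then show ?case by auto
next
  case (Suc n)
  obtain A Vs' where V: "Vs = A # Vs'" "svf A" "svfs Vs'" "length Vs' = n"
    using Suc.hyps(2) Suc.prems(2) by (cases Vs) auto
  obtain B Ws' where W: "Ws = B # Ws'" "svf B" "svfs Ws'" "A x = B x" "ev Vs' x = ev Ws' x"
    using Suc.prems(3,4) V(1) by (cases Ws) auto
  note \<phi> = Suc.prems(1)
  have tail: "Fd \<psi> (C # Us) x = Fd \<psi> (C # Us') x"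
    if "sform q \<psi>" "svf C" "svfs Us" "svfs Us'" "ev Us x = ev Us' x" "length Us = n" for \<psi> q C Us Us'
    using Fd_tail_cong[OF that(1-5)] Suc.hyps(1)[OF _ form_interior[OF that(1,2)] that(3-5)] that(6) by simp
  have "Fd \<phi> (A # Ws') x = Fd \<phi> (B # Ws') x"
  proof (cases Ws')
    \<comment> \<open>With no second argument to swap with, the value is the derivative of a
      function, which sees the head only at \<open>x\<close>.\<close>
    case Nil
    then show ?thesis
      using W(4) by (simp add: Fd_Cons[OF \<phi> V(2)] Fd_Cons[OF \<phi> W(2)] FL_Nil Fd_Nil)
  next
    case (Cons C Us)
    then have C: "svf C" "svfs Us" "length (A # Us) = n"
      using W V(4) map_eq_imp_length_eq[OF W(5)] by auto
    have "Fd \<phi> (A # C # Us) x = - Fd \<phi> (C # A # Us) x"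
      using Fd_swap[OF \<phi> V(2) C(1,2)] .
    also have "\<dots> = - Fd \<phi> (C # B # Us) x"
      using tail[OF \<phi> C(1), of "A # Us" "B # Us"] C V W by simp
    also have "\<dots> = Fd \<phi> (B # C # Us) x"
      using Fd_swap[OF \<phi> W(2) C(1,2)] by simp
    finally show ?thesis
      using Cons by simp
  qed
  then show ?case
    using tail[OF \<phi> V(2,3) W(3,5) V(4)] V(1) W(1) by simp
qed

lemma d_eval: "sform q \<phi> \<Longrightarrow> svfs Vs \<Longrightarrow> d \<phi> x (ev Vs x) = Fd \<phi> Vs x"
  unfolding d_eq_tensorial by (rule tensorial_eval) (auto intro: Fd_cong)

lemma d_junk: "\<not> set vs \<subseteq> T x \<Longrightarrow> d \<phi> x vs = 0"
  unfolding d_eq_tensorial by (rule tensorial_junk)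

lemma d_linear:
  assumes "sform q \<phi>" "sform q \<psi>"
  shows "d (\<lambda>x vs. a * \<phi> x vs + b * \<psi> x vs) = (\<lambda>x vs. a * d \<phi> x vs + b * d \<psi> x vs)"
  by (rule form_eqI)
     (simp_all add: d_junk d_eval[OF form_combination[OF assms]] d_eval[OF assms(1)] d_eval[OF assms(2)]
       Fd_linear[OF assms])

lemma d_zero: "d (\<lambda>x vs. 0) = (\<lambda>x vs. 0)"
  using d_linear[OF form_zero form_zero, of 0 0] by simp

lemma d_diff: "sform q \<phi> \<Longrightarrow> sform q \<psi> \<Longrightarrow> d (\<lambda>x vs. \<phi> x vs - \<psi> x vs) = (\<lambda>x vs. d \<phi> x vs - d \<psi> x vs)"
  using d_linear[of q \<phi> \<psi> 1 "-1"] by simp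

lemma interior_d:
  assumes \<phi>: "sform q \<phi>" and A: "svf A"
  shows "ii A (d \<phi>) = (\<lambda>x vs. L A \<phi> x vs - d (ii A \<phi>) x vs)"
proof (rule form_eqI)
  fix x vs assume "\<not> set vs \<subseteq> T x"
  then show "ii A (d \<phi>) x vs = L A \<phi> x vs - d (ii A \<phi>) x vs"
    by (simp add: interior_apply L_junk d_junk)
next
  fix x Vs assume Vs: "svfs Vs"
  then show "ii A (d \<phi>) x (ev Vs x) = L A \<phi> x (ev Vs x) - d (ii A \<phi>) x (ev Vs x)"
    using d_eval[OF \<phi>, of "A # Vs" x] d_eval[OF form_interior[OF \<phi> A] Vs] L_eval[OF \<phi> A Vs] Fd_Cons[OF \<phi> A Vs] A
    by (simp add: interior_apply)
qed

lemma sform_d: "sform q \<phi> \<Longrightarrow> sform (Suc q) (d \<phi>)"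
proof (induction q arbitrary: \<phi>)
  have head_linear: "d \<phi> x ((\<lambda>f. a * u f + b * w f) # vs) = a * d \<phi> x (u # vs) + b * d \<phi> x (w # vs)"
    if \<phi>: "sform q \<phi>" and uw: "u \<in> T x" "w \<in> T x" for q \<phi> x u w a b vs
  proof -
    note UW = svf_extend[of x u] svf_extend[of x w]
    have "ii (\<lambda>y f. a * extend x u y f + b * extend x w y f) (d \<phi>) x vs
        = a * ii (extend x u) (d \<phi>) x vs + b * ii (extend x w) (d \<phi>) x vs"
      unfolding interior_d[OF \<phi> svf_combination[OF UW]] interior_d[OF \<phi> UW(1)] interior_d[OF \<phi> UW(2)]
        interior_combination[OF \<phi> UW] L_field_linear[OF \<phi> UW]
        d_linear[OF form_interior[OF \<phi> UW(1)] form_interior[OF \<phi> UW(2)]]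
      by (simp add: algebra_simps)
    then show ?thesis
      using uw by (simp add: interior_apply)
  qed
  \<comment> \<open>Since i_V i_V kills the form, Cartan's formula turns i_V d i_V into L_V i_V; as
    [V,V] = 0, this is also i_V L_V, and i_V i_V d is the difference of the two.\<close>
  have twice: "d \<phi> x (v # v # vs) = 0" if \<phi>: "sform q \<phi>" and v: "v \<in> T x" for q \<phi> x v vs
  proof -
    let ?V = "extend x v"
    note V = svf_extend[of x v]
    have "ii ?V (ii ?V \<phi>) = (\<lambda>x vs. 0)"
      using form_head_twice[OF \<phi>] by (simp add: interior_apply fun_eq_iff)
    then have "ii ?V (d (ii ?V \<phi>)) = (\<lambda>x vs. L ?V (ii ?V \<phi>) x vs)"
      using interior_d[OF form_interior[OF \<phi> V] V] d_zero by simp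
    moreover have "bracket \<A> ?V ?V y = (\<lambda>f. 0)" for y
      by (simp add: bracket_def fun_eq_iff)
    then have "ii ?V (L ?V \<phi>) = (\<lambda>x vs. L ?V (ii ?V \<phi>) x vs)"
      unfolding interior_L[OF \<phi> V V] by (simp add: interior_apply form_head_zero[OF \<phi>])
    moreover have "ii ?V (ii ?V (d \<phi>)) = (\<lambda>x vs. ii ?V (L ?V \<phi>) x vs - ii ?V (d (ii ?V \<phi>)) x vs)"
      unfolding interior_d[OF \<phi> V] by (simp add: interior_product_def)
    ultimately have "ii ?V (ii ?V (d \<phi>)) x vs = 0"
      by simp
    then show ?thesis
      using v by (simp add: interior_apply)
  qed
  \<comment> \<open>Both cases of the induction share this argument; in degree 0 the contraction is
    zero and \<open>int\<close> is trivial.\<close>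
  have step: "sform (Suc q) (d \<phi>)" if \<phi>: "sform q \<phi>" and int: "\<And>A. svf A \<Longrightarrow> sform q (d (ii A \<phi>))" for q \<phi>
  proof (rule form_SucI)
    show "d \<phi> x [] = 0" for x
      using d_eval[OF \<phi>, of "[]" x] by (simp add: Fd_Nil)
    show "d \<phi> x (v # vs) = 0" if "v \<notin> T x" for x v vs
      using that by (intro d_junk) auto
    show "sform q (ii A (d \<phi>))" if A: "svf A" for A
      unfolding interior_d[OF \<phi> A] by (intro form_diff sform_L \<phi> A int)
  qed (fact head_linear[OF \<phi>], fact twice[OF \<phi>])
  {
    case 0
    then show ?case
      by (intro step) (simp_all add: form_interior_0 d_zero form_zero)
  next
    case (Suc q)
    then show ?case
      by (intro step Suc.IH form_interior_Suc)
  }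
qed

text \<open>Contract with B. Cartan's formula, the commutation of i_B with L_A and the induction
  hypothesis turn both sides into L_B L_A - L_A d i_B + d i_[A,B]; \<open>L_bracket\<close> removes
  the L_[A,B] that appears on the right.\<close>

lemma d_L:
  assumes A: "svf A"
  shows "sform q \<phi> \<Longrightarrow> d (L A \<phi>) = L A (d \<phi>)"
proof (induction q arbitrary: \<phi>)
  \<comment> \<open>\<open>sm\<close> is a separate premise because \<open>sform_d\<close> would
    give degree \<open>Suc (q - 1)\<close>, which differs from q at q = 0; there the form in
    question is zero.\<close>
  have step: "d (L A \<phi>) = L A (d \<phi>)"
    if \<phi>: "sform q \<phi>" and int: "\<And>B. svf B \<Longrightarrow> d (L A (ii B \<phi>)) = L A (d (ii B \<phi>))"
      and sm: "\<And>B. svf B \<Longrightarrow> sform q (d (ii B \<phi>))" for q \<phi>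
  proof (rule form_Suc_eqI)
    show "sform (Suc q) (d (L A \<phi>))" "sform (Suc q) (L A (d \<phi>))"
      by (intro sform_d sform_L \<phi> A)+
    fix B assume B: "svf B"
    note AB = svf_bracket[OF A B]
    have "ii B (d (L A \<phi>)) = (\<lambda>x vs. L B (L A \<phi>) x vs
        - (L A (d (ii B \<phi>)) x vs - d (ii (bracket \<A> A B) \<phi>) x vs))"
      unfolding interior_d[OF sform_L[OF \<phi> A] B] interior_L[OF \<phi> A B]
        d_diff[OF sform_L[OF form_interior[OF \<phi> B] A] form_interior[OF \<phi> AB]] int[OF B] ..
    moreover have "ii B (L A (d \<phi>)) = (\<lambda>x vs. L A (L B \<phi>) x vs - L A (d (ii B \<phi>)) x vs
        - ((L A (L B \<phi>) x vs - L B (L A \<phi>) x vs) - d (ii (bracket \<A> A B) \<phi>) x vs))"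
      unfolding interior_L[OF sform_d[OF \<phi>] A B] interior_d[OF \<phi> B] interior_d[OF \<phi> AB]
        L_diff[OF sform_L[OF \<phi> B] sm[OF B] A] L_bracket[OF A B \<phi>] ..
    ultimately show "ii B (d (L A \<phi>)) = ii B (L A (d \<phi>))"
      by (simp add: fun_eq_iff)
  qed
  {
    case 0
    show ?case
      by (rule step[OF 0]) (simp_all add: form_interior_0[OF 0] d_zero form_zero L_zero[OF A])
  next
    case (Suc q)
    show ?case
      by (rule step[OF Suc.prems]) (intro Suc.IH sform_d form_interior_Suc[OF Suc.prems]; assumption)+
  }
qed

text \<open>Cartan's formula is applied to the outer Lie derivative and d is moved past the inner
  one, so that i_A L_A, the summand of \<open>bar_delta\<close>, occurs in both terms.\<close>

lemma L_L_decomposition: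
  assumes \<phi>: "sform q \<phi>" and A: "svf A"
  shows "L A (L A \<phi>) = (\<lambda>x vs. ii A (L A (d \<phi>)) x vs + d (ii A (L A \<phi>)) x vs)"
  using interior_d[OF sform_L[OF \<phi> A] A] d_L[OF A \<phi>] by (simp add: fun_eq_iff)

end


section \<open>The adjoint connection\<close>

lemma orthonormal_expansion:
  fixes e :: "'m::finite \<Rightarrow> real^'m"
  assumes e: "\<And>i j. e i \<bullet> e j = (if i = j then 1 else 0)"
  shows "(\<Sum>i\<in>UNIV. (e i \<bullet> w) *\<^sub>R e i) = w"
proof -
  have inj: "inj e"
    by (rule injI) (metis e zero_neq_one)
  have orth: "pairwise orthogonal (range e)"
    using e by (auto simp: pairwise_def orthogonal_def)
  have "0 \<notin> range e"
    using e by (metis inner_zero_left rangeE zero_neq_one)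
  then have ind: "independent (range e)"
    using orth by (intro pairwise_orthogonal_independent)
  have "card (range e) = DIM(real^'m)"
    using card_image[OF inj] by simp
  then have "w \<in> span (range e)"
    using card_ge_dim_independent[OF subset_UNIV ind] by auto
  moreover have "norm v = 1" if "v \<in> range e" for v
    using that e by (auto simp: norm_eq_1)
  ultimately have "(\<Sum>v\<in>range e. (v \<bullet> w) *\<^sub>R v) = w"
    using orthonormal_basis_expand[OF orth, of w] by (simp add: inner_commute)
  then show ?thesis
    using sum.reindex[OF inj, of "\<lambda>v. (v \<bullet> w) *\<^sub>R v"] by simp
qed

text \<open>Insert P in the first slot and expand P(e_i) in the basis; self-adjointness and an
  exchange of sums carry P to the second slot, where B vanishes.\<close>

lemma orthonormal_trace_zero:
  fixes e :: "'m::finite \<Rightarrow> real^'m" and B :: "real^'m \<Rightarrow> real^'m \<Rightarrow> real"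
  assumes e: "\<And>i j. e i \<bullet> e j = (if i = j then 1 else 0)"
    and B: "\<And>v. linear (\<lambda>u. B u v)" "\<And>u. linear (B u)"
    and P: "\<And>u v. P u \<bullet> v = u \<bullet> P v"
    and BP: "\<And>u v. B (P u) v = B u v" "\<And>u v. B u (P v) = 0"
  shows "(\<Sum>i\<in>UNIV. B (e i) (e i)) = 0"
proof -
  have "B (e i) (e i) = (\<Sum>k\<in>UNIV. (e i \<bullet> P (e k)) * B (e k) (e i))" for i
  proof -
    have "B (e i) (e i) = B (\<Sum>k\<in>UNIV. (e k \<bullet> P (e i)) *\<^sub>R e k) (e i)"
      by (simp add: orthonormal_expansion[OF e] BP)
    also have "\<dots> = (\<Sum>k\<in>UNIV. (e k \<bullet> P (e i)) * B (e k) (e i))"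
      by (simp add: linear_sum[OF B(1)] linear_scale[OF B(1)])
    also have "\<dots> = (\<Sum>k\<in>UNIV. (e i \<bullet> P (e k)) * B (e k) (e i))"
      by (rule sum.cong[OF refl]) (metis P inner_commute)
    finally show ?thesis .
  qed
  then have "(\<Sum>i\<in>UNIV. B (e i) (e i)) = (\<Sum>k\<in>UNIV. \<Sum>i\<in>UNIV. (e i \<bullet> P (e k)) * B (e k) (e i))"
    by (subst sum.swap) simp
  also have "\<dots> = (\<Sum>k\<in>UNIV. B (e k) (\<Sum>i\<in>UNIV. (e i \<bullet> P (e k)) *\<^sub>R e i))"
    by (simp add: linear_sum[OF B(2)] linear_scale[OF B(2)])
  also have "\<dots> = 0"
    by (simp add: orthonormal_expansion[OF e] BP)
  finally show ?thesis .
qed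

context LW_structure
begin

section \<open>The projection P = Y X and its derivative\<close>

lemma adjoint_map_combination:
  assumes "u \<in> T x" "v \<in> T x"
  shows "Y x (\<lambda>f. a * u f + b * v f) = a *\<^sub>R Y x u + b *\<^sub>R Y x v"
proof -
  have "a *\<^sub>R Y x u + b *\<^sub>R Y x v \<in> (ker x)\<^sup>\<bottom>"
    using adjoint_map_ker_perp assms subspace_orthogonal_comp subspace_add subspace_mul by metis
  from adjoint_map_eq[OF this] show ?thesis
    using assms by (simp add: X_combination)
qed

definition P :: "'a \<Rightarrow> real^'m \<Rightarrow> real^'m"
  where "P x w = Y x (X x w)"

lemma P_combination: "P x (a *\<^sub>R v + b *\<^sub>R w) = a *\<^sub>R P x v + b *\<^sub>R P x w"
  by (simp add: P_def X_combination adjoint_map_combination X_tangent)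

lemma linear_P: "linear (P x)"
  using P_combination[of x 1 _ 1] P_combination[of x _ _ 0 0] by (intro linearI) auto

lemma P_idem: "P x (P x w) = P x w"
  by (simp add: P_def X_tangent)

lemma X_P: "X x (P x w) = X x w"
  by (simp add: P_def X_tangent)

lemma P_selfadjoint: "P x u \<bullet> v = u \<bullet> P x v"
proof -
  have "P x u \<bullet> v = P x u \<bullet> P x v" for u v
  proof -
    have "v - P x v \<in> ker x"
      by (simp add: ker_def X_diff X_P)
    then have "P x u \<bullet> (v - P x v) = 0"
      using ker_perp_inner adjoint_map_ker_perp X_tangent unfolding P_def by blast
    then show ?thesis
      by (simp add: inner_diff_right)
  qed
  then show ?thesis
    by (metis inner_commute)
qed

lemma P_axis_sum: "P x w $ j = (\<Sum>k\<in>UNIV. w $ k * P x (axis k 1) $ j)"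
proof -
  have "P x w = P x (\<Sum>k\<in>UNIV. w $ k *\<^sub>R axis k 1)"
    using basis_expansion[of w] by (simp add: scalar_mult_eq_scaleR)
  then show ?thesis
    by (simp add: linear_sum[OF linear_P] linear_scale[OF linear_P])
qed

lemma smooth_P: "smooth_at x (\<lambda>y. P y w $ j)"
  unfolding P_def by (rule smooth_adjoint_map[OF X_smooth])

text \<open>The LeJan-Watanabe derivative of X(.)w along \<open>z\<close>, formulated for a single
  vector \<open>z\<close> so that its pointwise nature is built in.\<close>

definition DX :: "'a \<Rightarrow> real^'m \<Rightarrow> 'a tangent \<Rightarrow> 'a tangent"
  where "DX x w z = X x (\<chi> j. z (\<lambda>y. P y w $ j))"

lemma LW_connection_X: "LW_connection X V (\<lambda>y. X y w) x = DX x w (V x)"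
  by (simp add: LW_connection_def DX_def P_def)

lemma DX_tangent: "DX x w z \<in> T x"
  unfolding DX_def by (rule X_tangent)

lemma DX_combination_left:
  assumes z: "z \<in> T x"
  shows "DX x (a *\<^sub>R v + b *\<^sub>R w) z = (\<lambda>f. a * DX x v z f + b * DX x w z f)"
proof -
  have "(\<chi> j. z (\<lambda>y. P y (a *\<^sub>R v + b *\<^sub>R w) $ j))
      = a *\<^sub>R (\<chi> j. z (\<lambda>y. P y v $ j)) + b *\<^sub>R (\<chi> j. z (\<lambda>y. P y w $ j))"
    by (simp add: vec_eq_iff P_combination tangent_linear[OF z] smooth_P)
  then show ?thesis
    by (simp add: DX_def X_combination)
qed

lemma DX_combination_right:
  "DX x w (\<lambda>f. a * z f + b * z' f) = (\<lambda>f. a * DX x w z f + b * DX x w z' f)"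
proof -
  have "(\<chi> j. a * z (\<lambda>y. P y w $ j) + b * z' (\<lambda>y. P y w $ j))
      = a *\<^sub>R (\<chi> j. z (\<lambda>y. P y w $ j)) + b *\<^sub>R (\<chi> j. z' (\<lambda>y. P y w $ j))"
    by (simp add: vec_eq_iff)
  then show ?thesis
    by (simp add: DX_def X_combination)
qed

text \<open>Differentiating \<open>P P = P\<close> gives \<open>P (dP) P = 0\<close>.\<close>

lemma DX_P:
  assumes z: "z \<in> T x"
  shows "DX x (P x w) z = (\<lambda>f. 0)"
proof -
  define n where "n = P x w"
  define D where "D = (\<chi> j. z (\<lambda>y. P y n $ j))"
  have n: "P x n = n"
    by (simp add: n_def P_idem)
  have "P x D $ j = 0" for j
  proof -
    \<comment> \<open>Differentiate P(y)n = P(y)P(y)n entrywise with n = P(x)n held fixed. At x the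
      Leibniz rule reads D = D + P(x)D, whence X(x)D = X(x)P(x)D = 0.\<close>
    have "D $ j = z (\<lambda>y. \<Sum>k\<in>UNIV. P y n $ k * P y (axis k 1) $ j)"
    proof -
      have "P y n $ j = (\<Sum>k\<in>UNIV. P y n $ k * P y (axis k 1) $ j)" for y
        using P_axis_sum[of y "P y n" j] by (simp add: P_idem)
      then show ?thesis
        by (simp add: D_def)
    qed
    also have "\<dots> = (\<Sum>k\<in>UNIV. n $ k * z (\<lambda>y. P y (axis k 1) $ j) + P x (axis k 1) $ j * D $ k)"
      by (subst tangent_sum[OF z])
         (auto intro!: smooth_at_mult smooth_P simp: tangent_mult[OF z smooth_P smooth_P] n D_def)
    also have "\<dots> = (\<Sum>k\<in>UNIV. n $ k * z (\<lambda>y. P y (axis k 1) $ j)) + P x D $ j"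
      by (simp add: sum.distrib P_axis_sum[of x D] mult.commute)
    also have "(\<Sum>k\<in>UNIV. n $ k * z (\<lambda>y. P y (axis k 1) $ j)) = z (\<lambda>y. \<Sum>k\<in>UNIV. n $ k * P y (axis k 1) $ j)"
      by (subst tangent_sum[OF z]) (auto intro!: smooth_at_mult smooth_at_const smooth_P simp: tangent_scale[OF z smooth_P])
    also have "\<dots> = D $ j"
      using P_axis_sum[of _ n j] by (simp add: D_def)
    finally show ?thesis by simp
  qed
  then have "P x D = 0"
    by (simp add: vec_eq_iff)
  then have "X x D = X x 0"
    using X_P[of x D] by simp
  then show ?thesis
    using X_combination[of x 0 0 0 0] by (simp add: DX_def D_def n_def)
qed

section \<open>Comparison of the adjoint connection with the Lie derivative\<close>

definition FA :: "'a vfield \<Rightarrow> 'a form \<Rightarrow> 'a vfield list \<Rightarrow> 'a \<Rightarrow> real"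
  where "FA V \<phi> = (\<lambda>Zs x. V x (\<lambda>y. \<phi> y (ev Zs y)) -
    (\<Sum>j<length Zs. \<phi> x ((ev Zs x)[j := adjoint_connection \<A> X V (Zs ! j) x])))"

lemma adjoint_connection_form_eq_tensorial: "adjoint_connection_form \<A> X V \<phi> = tensorial \<A> (FA V \<phi>)"
  by (simp add: adjoint_connection_form_def FA_def)

text \<open>Inserting the torsion into the adjoint connection along V leaves [V,Z] plus the
  LeJan-Watanabe derivative of V along Z. The bracket belongs to the Lie derivative; for V = X(.)w
  the rest is \<open>DX\<close>.\<close>

lemma FA_eq:
  assumes \<phi>: "sform q \<phi>" and Zs: "svfs Zs"
  shows "FA (\<lambda>y. X y w) \<phi> Zs x
    = FL (\<lambda>y. X y w) \<phi> Zs x - (\<Sum>j<length Zs. \<phi> x ((ev Zs x)[j := DX x w (ev Zs x ! j)]))"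
proof -
  have "\<phi> x ((ev Zs x)[j := adjoint_connection \<A> X (\<lambda>y. X y w) (Zs ! j) x])
      = \<phi> x ((ev Zs x)[j := bracket \<A> (\<lambda>y. X y w) (Zs ! j) x]) + \<phi> x ((ev Zs x)[j := DX x w (ev Zs x ! j)])"
    if j: "j < length Zs" for j
  proof (cases "length Zs = q")
    case True
    have "svf (Zs ! j)"
      using Zs j by simp
    note t = svf_tangent[OF svf_bracket[OF X_smooth this]]
    have "adjoint_connection \<A> X (\<lambda>y. X y w) (Zs ! j) x
        = (\<lambda>f. 1 * bracket \<A> (\<lambda>y. X y w) (Zs ! j) x f + 1 * DX x w (ev Zs x ! j) f)"
      using j by (simp add: adjoint_connection_def LW_torsion_def LW_connection_X add.commute)
    then show ?thesis
      using form_multilinear[OF \<phi> _ ev_tangent[OF Zs] _ t DX_tangent, where i = j and a = 1 and b = 1] True j by simp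
  qed (simp add: form_junk[OF \<phi>])
  then show ?thesis
    unfolding FA_def FL_def by (simp add: sum.distrib)
qed

text \<open>Pointwise dependence is inherited from the Lie derivative, as the correction uses the
  fields at x only.\<close>

lemma adjoint_connection_form_eval:
  assumes \<phi>: "sform q \<phi>" and vs: "set vs \<subseteq> T x"
  shows "adjoint_connection_form \<A> X (\<lambda>y. X y w) \<phi> x vs
    = L (\<lambda>y. X y w) \<phi> x vs - (\<Sum>j<length vs. \<phi> x (vs[j := DX x w (vs ! j)]))"
proof -
  obtain Zs where Zs: "svfs Zs" "ev Zs x = vs"
    using extend_list[OF vs] by blast
  have FA: "FA (\<lambda>y. X y w) \<phi> Ws x
    = L (\<lambda>y. X y w) \<phi> x (ev Ws x) - (\<Sum>j<length (ev Ws x). \<phi> x ((ev Ws x)[j := DX x w (ev Ws x ! j)]))"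
    if "svfs Ws" for Ws
    using FA_eq[OF \<phi> that] L_eval[OF \<phi> X_smooth that] by simp
  have "tensorial \<A> (FA (\<lambda>y. X y w) \<phi>) x (ev Zs x) = FA (\<lambda>y. X y w) \<phi> Zs x"
  proof (rule tensorial_eval[OF Zs(1)])
    fix Ws assume "svfs Ws" "ev Ws x = ev Zs x"
    then show "FA (\<lambda>y. X y w) \<phi> Ws x = FA (\<lambda>y. X y w) \<phi> Zs x"
      unfolding FA[OF Zs(1)] FA[OF \<open>svfs Ws\<close>] by (simp only:)
  qed
  then show ?thesis
    using FA[OF Zs(1)] Zs(2) by (simp add: adjoint_connection_form_eq_tensorial)
qed

text \<open>As a bilinear form in (u, v), the first variable enters through X(x)u = X(x)P(x)u, and
  the second through \<open>DX\<close>, which annihilates the image of P(x).\<close>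

lemma trace_correction_head:
  fixes e :: "'m \<Rightarrow> real^'m"
  assumes e: "\<And>i j. e i \<bullet> e j = (if i = j then 1 else 0)" and \<phi>: "sform q \<phi>"
  shows "(\<Sum>i\<in>UNIV. \<phi> x (DX x (e i) (X x (e i)) # vs)) = 0"
proof (rule orthonormal_trace_zero[OF e, where B = "\<lambda>u v. \<phi> x (DX x v (X x u) # vs)" and P = "P x"])
  have 1: "\<phi> x (DX x v (X x (a *\<^sub>R u + b *\<^sub>R w)) # vs)
      = a * \<phi> x (DX x v (X x u) # vs) + b * \<phi> x (DX x v (X x w) # vs)" for a b u v w
    by (simp add: X_combination DX_combination_right form_head_linear[OF \<phi> DX_tangent DX_tangent])
  show "linear (\<lambda>u. \<phi> x (DX x v (X x u) # vs))" for v
    using 1[of v 1 _ 1] 1[of v _ _ 0 0] by (intro linearI) auto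
  have 2: "\<phi> x (DX x (a *\<^sub>R v + b *\<^sub>R w) (X x u) # vs)
      = a * \<phi> x (DX x v (X x u) # vs) + b * \<phi> x (DX x w (X x u) # vs)" for a b u v w
    by (simp add: DX_combination_left[OF X_tangent] form_head_linear[OF \<phi> DX_tangent DX_tangent])
  show "linear (\<lambda>v. \<phi> x (DX x v (X x u) # vs))" for u
    using 2[of 1 _ 1] 2[of _ _ 0 0] by (intro linearI) auto
qed (simp_all add: P_selfadjoint X_P DX_P[OF X_tangent] form_head_zero[OF \<phi>])

text \<open>The same two properties hold with the variables in different slots: X(x)u sits in the
  head and the derivative term in slot \<open>j\<close> of the tail.\<close>

lemma trace_correction_tail:
  fixes e :: "'m \<Rightarrow> real^'m"
  assumes e: "\<And>i j. e i \<bullet> e j = (if i = j then 1 else 0)" and \<phi>: "sform q \<phi>"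
    and vs: "set vs \<subseteq> T x" "j < length vs"
  shows "(\<Sum>i\<in>UNIV. \<phi> x (X x (e i) # vs[j := DX x (e i) (vs ! j)])) = 0"
proof (rule orthonormal_trace_zero[OF e, where B = "\<lambda>u v. \<phi> x (X x u # vs[j := DX x v (vs ! j)])" and P = "P x"])
  have 1: "\<phi> x (X x (a *\<^sub>R u + b *\<^sub>R w) # vs') = a * \<phi> x (X x u # vs') + b * \<phi> x (X x w # vs')" for a b u w vs'
    by (simp add: X_combination form_head_linear[OF \<phi> X_tangent X_tangent])
  show "linear (\<lambda>u. \<phi> x (X x u # vs[j := DX x v (vs ! j)]))" for v
    using 1[of 1 _ 1] 1[of _ _ 0 0] by (intro linearI) auto
  have z: "vs ! j \<in> T x"
    using vs nth_mem by blast
  have slot: "\<phi> x (X x u # vs[j := (\<lambda>f. a * v f + b * w f)])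
      = a * \<phi> x (X x u # vs[j := v]) + b * \<phi> x (X x u # vs[j := w])"
    if "v \<in> T x" "w \<in> T x" for a b u v w
  proof (cases "Suc (length vs) = q")
    case True
    then show ?thesis
      using form_multilinear[OF \<phi>, of "X x u # vs" x "Suc j" v w a b] vs that X_tangent by auto
  qed (simp add: form_junk[OF \<phi>])
  have 2: "\<phi> x (X x u # vs[j := DX x (a *\<^sub>R v + b *\<^sub>R w) (vs ! j)])
      = a * \<phi> x (X x u # vs[j := DX x v (vs ! j)]) + b * \<phi> x (X x u # vs[j := DX x w (vs ! j)])" for a b u v w
    by (simp add: DX_combination_left[OF z] slot DX_tangent)
  show "linear (\<lambda>v. \<phi> x (X x u # vs[j := DX x v (vs ! j)]))" for u
    using 2[of u 1 _ 1] 2[of u _ _ 0 0] by (intro linearI) auto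
  show "\<phi> x (X x u # vs[j := DX x (P x v) (vs ! j)]) = 0" for u v
    using slot[OF tangent_zero tangent_zero, of u 0 0] by (simp add: DX_P[OF z])
qed (simp_all add: P_selfadjoint X_P)

lemma bar_delta_eq:
  fixes e :: "'m \<Rightarrow> real^'m"
  assumes e: "\<And>i j. e i \<bullet> e j = (if i = j then 1 else 0)" and \<phi>: "sform q \<phi>"
  shows "bar_delta \<A> X e \<phi> = (\<lambda>x vs. - (\<Sum>i\<in>UNIV. ii (\<lambda>y. X y (e i)) (L (\<lambda>y. X y (e i)) \<phi>) x vs))"
proof (intro ext)
  fix x vs
  show "bar_delta \<A> X e \<phi> x vs = - (\<Sum>i\<in>UNIV. ii (\<lambda>y. X y (e i)) (L (\<lambda>y. X y (e i)) \<phi>) x vs)"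
  proof (cases "set vs \<subseteq> T x")
    case True
    then have Xvs: "set (X x (e i) # vs) \<subseteq> T x" for i
      using X_tangent by simp
    \<comment> \<open>Slot 0 holds X(x)e_i itself and gives the head trace. For the later slots the
      sums are exchanged, so that each fixed slot becomes one trace over the basis.\<close>
    have "(\<Sum>i\<in>UNIV. \<Sum>j<length (X x (e i) # vs). \<phi> x ((X x (e i) # vs)[j := DX x (e i) ((X x (e i) # vs) ! j)]))
        = (\<Sum>i\<in>UNIV. \<phi> x (DX x (e i) (X x (e i)) # vs))
          + (\<Sum>i\<in>UNIV. \<Sum>j<length vs. \<phi> x (X x (e i) # vs[j := DX x (e i) (vs ! j)]))"
      by (simp add: sum.lessThan_Suc_shift sum.distrib del: sum.lessThan_Suc)
    also have "\<dots> = (\<Sum>j<length vs. \<Sum>i\<in>UNIV. \<phi> x (X x (e i) # vs[j := DX x (e i) (vs ! j)]))"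
      by (subst sum.swap) (simp add: trace_correction_head[OF e \<phi>])
    also have "\<dots> = 0"
      by (rule sum.neutral) (use trace_correction_tail[OF e \<phi> True] in auto)
    finally show ?thesis
      unfolding bar_delta_def interior_apply adjoint_connection_form_eval[OF \<phi> Xvs] by (simp add: sum_subtractf)
  next
    case False
    \<comment> \<open>On lists with a non-tangent entry both sides take the default value 0 of
      \<open>tensorial\<close>.\<close>
    then have "\<not> set (v # vs) \<subseteq> T x" for v
      by simp
    then show ?thesis
      unfolding bar_delta_def interior_apply adjoint_connection_form_eq_tensorial L_eq_tensorial
      by (simp add: tensorial_junk del: set_simps)
  qed
qed

text \<open>Being a form is proved along with the formula because \<open>d_diff\<close> asks it of
  the partial sums. With the minus sign inside, each new summand is a plain subtraction.\<close>

lemma d_uminus_sum: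
  fixes \<psi> :: "'c \<Rightarrow> 'a form"
  assumes "finite I" "\<And>i. i \<in> I \<Longrightarrow> sform q (\<psi> i)"
  shows "sform q (\<lambda>x vs. - (\<Sum>i\<in>I. \<psi> i x vs)) \<and> d (\<lambda>x vs. - (\<Sum>i\<in>I. \<psi> i x vs)) = (\<lambda>x vs. - (\<Sum>i\<in>I. d (\<psi> i) x vs))"
  using assms
proof (induction I rule: finite_induct)
  case empty
  then show ?case by (simp add: form_zero d_zero)
next
  case (insert i I)
  then have IH: "sform q (\<lambda>x vs. - (\<Sum>i\<in>I. \<psi> i x vs))"
      "d (\<lambda>x vs. - (\<Sum>i\<in>I. \<psi> i x vs)) = (\<lambda>x vs. - (\<Sum>i\<in>I. d (\<psi> i) x vs))"
    and \<psi>: "sform q (\<psi> i)"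
    by auto
  have sum: "(\<lambda>x vs. - (\<Sum>i\<in>insert i I. F i x vs)) = (\<lambda>x vs. - (\<Sum>i\<in>I. F i x vs) - F i x vs)"
    for F :: "'c \<Rightarrow> 'a form"
    using insert.hyps by (simp add: fun_eq_iff)
  show ?case
    unfolding sum d_diff[OF IH(1) \<psi>] IH(2) using form_diff[OF IH(1) \<psi>] by blast
qed

text \<open>Summing the decomposition of L_A L_A over A = X(.)e_i, the first formula is used in
  degree q + 1 for the exterior derivative and in degree q for the form itself.\<close>

lemma sum_L_L_eq:
  fixes e :: "'m \<Rightarrow> real^'m"
  assumes e: "\<And>i j. e i \<bullet> e j = (if i = j then 1 else 0)" and \<phi>: "sform q \<phi>"
  shows "(\<lambda>x vs. \<Sum>i\<in>UNIV. L (\<lambda>y. X y (e i)) (L (\<lambda>y. X y (e i)) \<phi>) x vs)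
    = (\<lambda>x vs. - bar_delta \<A> X e (d \<phi>) x vs - d (bar_delta \<A> X e \<phi>) x vs)"
proof -
  have "d (bar_delta \<A> X e \<phi>) = (\<lambda>x vs. - (\<Sum>i\<in>UNIV. d (ii (\<lambda>y. X y (e i)) (L (\<lambda>y. X y (e i)) \<phi>)) x vs))"
    unfolding bar_delta_eq[OF e \<phi>]
    by (rule conjunct2[OF d_uminus_sum]) (auto intro!: form_interior[OF sform_L[OF \<phi> X_smooth] X_smooth])
  then show ?thesis
    by (simp add: bar_delta_eq[OF e sform_d[OF \<phi>]] L_L_decomposition[OF \<phi> X_smooth] sum.distrib)
qed

end

theorem mainTheorem9:
  fixes \<A> :: "('a::{t2_space, second_countable_topology}, 'e::euclidean_space) chart set"
    and X :: "'a \<Rightarrow> real^'m \<Rightarrow> 'a tangent"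
    and e :: "'m::finite \<Rightarrow> real^'m"
    and Xi :: "'m \<Rightarrow> 'a vfield"
    and q :: nat
    and \<phi> :: "'a form"
  assumes manifold: "smooth_atlas \<A>"
    and X_linear: "\<And>x f. linear (\<lambda>w. X x w f)"
    and X_onto: "\<And>x. range (X x) = tangent_space \<A> x"
    and X_smooth: "\<And>w. smooth_vfield \<A> (\<lambda>x. X x w)"
    and e_orthonormal: "\<And>i j. e i \<bullet> e j = (if i = j then 1 else 0)"
    and Xi: "\<And>i. Xi i = (\<lambda>x. X x (e i))"
    and form: "smooth_form \<A> q \<phi>"
  shows "bar_delta \<A> X e \<phi> =
      (\<lambda>x vs. - (\<Sum>i\<in>UNIV. interior_product (Xi i) (lie_derivative \<A> (Xi i) \<phi>) x vs)) \<and>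
    (\<lambda>x vs. \<Sum>i\<in>UNIV. lie_derivative \<A> (Xi i) (lie_derivative \<A> (Xi i) \<phi>) x vs) =
      (\<lambda>x vs. - bar_delta \<A> X e (ext_derivative \<A> \<phi>) x vs
             - ext_derivative \<A> (bar_delta \<A> X e \<phi>) x vs)"
proof -
  interpret LW_structure \<A> X
    by (intro LW_structure.intro smooth_manifold.intro LW_structure_axioms.intro manifold X_linear X_onto X_smooth)
  show ?thesis
    unfolding Xi using bar_delta_eq[OF e_orthonormal form] sum_L_L_eq[OF e_orthonormal form] by blast
qed

end
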